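(* Let $K$ be a field and let $L_2=(x_1^2,x_1x_2,\ldots,x_1x_{10},x_2^2,x_2x_3)$, a lex ideal in $S=K[x_1,\ldots,x_{10}]$ generated by monomials of degree $2$. Then $\mathrm{sdepth}(L_2)=5<\mathrm{hdepth}(L_2)=6$.
   Context: Let $S=K[x_1,\ldots,x_n]$. A Stanley decomposition of a monomial ideal $I\subset S$ is a direct sum decomposition of $K$-vector spaces $\mathcal{D}: I=\bigoplus_{i=1}^m m_iK[Z_i]$ with $m_i\in I$ monomials and $Z_i\subset\{x_1,\ldots,x_n\}$; $\mathrm{sdepth}(\mathcal{D})=\min_i|Z_i|$, and $\mathrm{sdepth}(I)$ is the maximum of $\mathrm{sdepth}(\mathcal{D})$ over all Stanley decompositions of $I$. Now let $S$ be $\mathbb{Z}$-graded with $\deg(x_i)=1$. A Hilbert decomposition of a graded ideal $I$ is an isomorphism of graded $K$-vector spaces $\mathcal{H}: I\cong\bigoplus_{i=1}^m K[Z_i](-s_i)$ with $s_i\in\mathbb{Z}_{\geq 0}$ and $Z_i\subset\{x_1,\ldots,x_n\}$; $\mathrm{hdepth}(\mathcal{H})=\min_i|Z_i|$, and $\mathrm{hdepth}(I)$ is the maximum of $\mathrm{hdepth}(\mathcal{H})$ over all Hilbert decompositions of $I$. A lex ideal is a monomial ideal $I$ such that whenever $u\in I$ and $v$ are monomials of the same degree with $v>_{\mathrm{lex}}u$ (with $x_1>x_2>\cdots$), then $v\in I$. *)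

theory Defs
  imports "HOL-Library.Poly_Mapping" "HOL-Algebra.Ideal"
begin

(* A monomial x_1^(a_1) ... x_n^(a_n) is its exponent vector (index i stands for x_i), and a
   polynomial is the finitely supported map from monomials to their coefficients; addition and
   multiplication are those of Poly_Mapping. *)

type_synonym mon = "nat \<Rightarrow>\<^sub>0 nat"
type_synonym 'k mpoly = "mon \<Rightarrow>\<^sub>0 'k"

definition var :: "nat \<Rightarrow> 'k::field mpoly" where
  "var i = Poly_Mapping.single (Poly_Mapping.single i 1) 1"

definition monom_poly :: "mon \<Rightarrow> 'k::field mpoly" where
  "monom_poly u = Poly_Mapping.single u 1"

definition const :: "'k::field \<Rightarrow> 'k mpoly" where
  "const c = Poly_Mapping.single 0 c"

definition mon_deg :: "mon \<Rightarrow> nat" where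
  "mon_deg u = (\<Sum>i\<in>Poly_Mapping.keys u. Poly_Mapping.lookup u i)"

(* The monomials of K[Z], and K[Z] itself, for a set Z of variables (given by their indices). *)

definition mons_in :: "nat set \<Rightarrow> mon set" where
  "mons_in Z = {u. Poly_Mapping.keys u \<subseteq> Z}"

definition polys_in :: "nat set \<Rightarrow> 'k::field mpoly set" where
  "polys_in Z = {f. Poly_Mapping.keys f \<subseteq> mons_in Z}"

definition poly_ring :: "nat \<Rightarrow> 'k::field mpoly ring" where
  "poly_ring n = \<lparr>carrier = polys_in {1..n}, mult = (*), one = 1, zero = 0, add = (+)\<rparr>"

(* Homogeneous polynomials of degree d for deg(x_i) = 1, including 0. *)

definition homogeneous :: "nat \<Rightarrow> 'k::field mpoly set" where
  "homogeneous d = {f. \<forall>u\<in>Poly_Mapping.keys f. mon_deg u = d}"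

definition monomial_ideal :: "nat \<Rightarrow> 'k::field mpoly set \<Rightarrow> bool" where
  "monomial_ideal n I \<longleftrightarrow>
     (\<exists>A \<subseteq> mons_in {1..n}. I = Idl\<^bsub>poly_ring n\<^esub> (monom_poly ` A))"

(* The order of Poly_Mapping on exponent vectors compares the entries at the smallest index where
   they differ, so u < v below means v >_lex u for x_1 > x_2 > ... *)

definition lex_ideal :: "nat \<Rightarrow> 'k::field mpoly set \<Rightarrow> bool" where
  "lex_ideal n I \<longleftrightarrow> monomial_ideal n I \<and>
     (\<forall>u\<in>mons_in {1..n}. \<forall>v\<in>mons_in {1..n}.
        monom_poly u \<in> I \<and> mon_deg v = mon_deg u \<and> u < v \<longrightarrow> monom_poly v \<in> I)"

(* A Stanley decomposition is the list of its pairs (m_i, Z_i). Each m_i K[Z_i] is a subspace, so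
   I is their internal direct sum iff summation is a bijection from their product onto I. *)

definition stanley_space :: "mon \<times> nat set \<Rightarrow> 'k::field mpoly set" where
  "stanley_space p = (\<lambda>f. monom_poly (fst p) * f) ` polys_in (snd p)"

definition stanley_decomp ::
  "nat \<Rightarrow> 'k::field mpoly set \<Rightarrow> (mon \<times> nat set) list \<Rightarrow> bool" where
  "stanley_decomp n I D \<longleftrightarrow>
     (\<forall>(u, Z)\<in>set D. u \<in> mons_in {1..n} \<and> monom_poly u \<in> I \<and> Z \<subseteq> {1..n}) \<and>
     bij_betw (\<lambda>w. \<Sum>i<length D. w i) (\<Pi>\<^sub>E i\<in>{..<length D}. stanley_space (D ! i)) I"

(* A Hilbert decomposition is given by the list of its pairs (s_i, Z_i). An element of the external
   direct sum of the K[Z_i](-s_i) is a family of polynomials, set to 0 beyond the last index. *)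

definition hilbert_space :: "(nat \<times> nat set) list \<Rightarrow> (nat \<Rightarrow> 'k::field mpoly) set" where
  "hilbert_space D =
     {w. (\<forall>i<length D. w i \<in> polys_in (snd (D ! i))) \<and> (\<forall>i\<ge>length D. w i = 0)}"

(* Degree d component: K[Z](-s)_d = K[Z]_(d-s), which is 0 for d < s. *)

definition hilbert_component ::
  "(nat \<times> nat set) list \<Rightarrow> nat \<Rightarrow> (nat \<Rightarrow> 'k::field mpoly) set" where
  "hilbert_component D d =
     {w \<in> hilbert_space D. \<forall>i<length D. \<forall>u\<in>Poly_Mapping.keys (w i). mon_deg u + fst (D ! i) = d}"

definition graded_iso ::
  "'k::field mpoly set \<Rightarrow> (nat \<times> nat set) list \<Rightarrow> ('k mpoly \<Rightarrow> nat \<Rightarrow> 'k mpoly) \<Rightarrow> bool" where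
  "graded_iso I D \<phi> \<longleftrightarrow>
     bij_betw \<phi> I (hilbert_space D) \<and>
     (\<forall>f\<in>I. \<forall>g\<in>I. \<phi> (f + g) = (\<lambda>i. \<phi> f i + \<phi> g i)) \<and>
     (\<forall>c. \<forall>f\<in>I. \<phi> (const c * f) = (\<lambda>i. const c * \<phi> f i)) \<and>
     (\<forall>d. \<phi> ` (I \<inter> homogeneous d) = hilbert_component D d)"

definition hilbert_decomp ::
  "nat \<Rightarrow> 'k::field mpoly set \<Rightarrow> (nat \<times> nat set) list \<Rightarrow> bool" where
  "hilbert_decomp n I D \<longleftrightarrow> (\<forall>(s, Z)\<in>set D. Z \<subseteq> {1..n}) \<and> (\<exists>\<phi>. graded_iso I D \<phi>)"

(* Meaningful for nonempty D only; the empty list decomposes just the zero ideal. *)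

definition decomp_depth :: "('a \<times> nat set) list \<Rightarrow> nat" where
  "decomp_depth D = Min ((\<lambda>(_, Z). card Z) ` set D)"

definition sdepth :: "nat \<Rightarrow> 'k::field mpoly set \<Rightarrow> nat" where
  "sdepth n I = Max {decomp_depth D | D. stanley_decomp n I D}"

definition hdepth :: "nat \<Rightarrow> 'k::field mpoly set \<Rightarrow> nat" where
  "hdepth n I = Max {decomp_depth D | D. hilbert_decomp n I D}"

end

theory Submission
  imports Defs "HOL-Computational_Algebra.Formal_Power_Series"
begin

text \<open>
  All spaces involved are spanned by monomials: a Stanley decomposition is the same as a partition
  of the monomials of the ideal into cones u K[Z], and a Hilbert decomposition exists iff the
  Hilbert functions of the two sides agree.

  Degrees 2 and 3 of L2 have dimensions 12 and 72. Each of the 12 generators has to head a summand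
  of its own, so summands with at least 7 variables would contribute 12 * 7 > 72 in degree 3. In
  a Stanley decomposition with at least 6 variables everywhere, the 11 generators other than x_2^2
  cover at least 66 monomials of degree 3, but the 8 products of x_2^2 with x_2, x_4, ..., x_10 are
  divisible by no other generator, and 66 + 8 > 72.

  A Stanley decomposition of depth 5 comes from partitioning the nonempty subsets of {x_2, ..., x_10}
  into intervals [A, B] with |B| \<ge> 5: the part x_1 (x_2, ..., x_10) K[x_2, ..., x_10] is the sum of
  the spaces x_1 x^A K[B]. A Hilbert decomposition of depth 6 is read off the expansion of the
  Hilbert series of L2 in powers of 1 / (1 - t).
\<close>

section \<open>Spaces spanned by monomials\<close>

text \<open>The two depths separate because 12 * 6 = 72: pieces with six variables at the twelve
  generators fill degree 3 exactly, so a dimension count cannot exclude depth 6. Only the position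
  of the monomials can. For the lower bound on sdepth, the cones x_1^2 S, x_2^2 K[x_2, ..., x_10]
  and x_2 x_3 K[x_3, ..., x_10] are large enough as they stand. What remains is x_1 times the
  maximal ideal in nine variables, and whether a monomial of it lies in x_1 x^A K[B] depends only on
  its support; hence intervals of sets. Nine is treated as three blocks of three because the
  nonempty subsets of a triple have a partition with tops of size at least 2, and 2 + 3 = 5. For
  hdepth only the numbers of variables matter. The summands use 6 variables up to degree 7 and then
  7, 8, 9, 10 variables in degrees 8 to 11, so that over the denominator (1 - t)^10 no numerator
  exceeds degree 11, the degree of the numerator of the series of L2. This shape already determines
  the multiplicities.\<close>

abbreviation lookup :: "('a \<Rightarrow>\<^sub>0 'b::zero) \<Rightarrow> 'a \<Rightarrow> 'b" where
  "lookup \<equiv> Poly_Mapping.lookup"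

abbreviation keys :: "('a \<Rightarrow>\<^sub>0 'b::zero) \<Rightarrow> 'a set" where
  "keys \<equiv> Poly_Mapping.keys"

abbreviation single :: "'a \<Rightarrow> 'b \<Rightarrow> 'a \<Rightarrow>\<^sub>0 'b::zero" where
  "single \<equiv> Poly_Mapping.single"

abbreviation coord :: "nat \<Rightarrow> mon" where
  "coord i \<equiv> single i (Suc 0)"

lemma poly_mapping_sum_single: "f = (\<Sum>u\<in>keys f. single u (lookup f u))"
proof (rule poly_mapping_eqI)
  fix k
  have "(\<Sum>u\<in>keys f. lookup (single u (lookup f u)) k)
      = (\<Sum>u\<in>keys f. if u = k then lookup f u else 0)"
    by (intro sum.cong) (auto simp: lookup_single when_def)
  then show "lookup f k = lookup (\<Sum>u\<in>keys f. single u (lookup f u)) k"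
    by (auto simp: lookup_sum sum.delta in_keys_iff)
qed

lemma keys_sum_subset: "(\<And>i. i \<in> A \<Longrightarrow> keys (f i) \<subseteq> M) \<Longrightarrow> keys (sum f A) \<subseteq> M"
proof (induction A rule: infinite_finite_induct)
  case (insert i A)
  have "keys (f i + sum f A) \<subseteq> keys (f i) \<union> keys (sum f A)" by (rule keys_add)
  also have "\<dots> \<subseteq> M" using insert by simp
  finally show ?case using insert.hyps by simp
qed simp_all

lemma lookup_const_mult: "lookup (const c * f) u = c * lookup f u"
  unfolding const_def by (simp add: mult_map_scale_conv_mult[symmetric] Poly_Mapping.map.rep_eq when_def)

lemma keys_const_mult: "keys (const c * f) \<subseteq> keys f"
  by (auto simp: in_keys_iff lookup_const_mult)

lemma const_mult_monom_poly: "const c * monom_poly u = single u c"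
  by (simp add: const_def monom_poly_def mult_single)

lemma keys_monom_poly: "keys (monom_poly u :: 'k::field mpoly) = {u}"
  by (simp add: monom_poly_def)

lemma monom_poly_neq_0: "monom_poly u \<noteq> (0 :: 'k::field mpoly)"
  by (metis keys_monom_poly keys_zero insert_not_empty)

section \<open>Exponent vectors and their degrees\<close>

lemma keys_add_mon: "keys (u + v :: mon) = keys u \<union> keys v"
  by (auto simp: in_keys_iff lookup_add)

lemma mons_in_add: "u + v \<in> mons_in Z \<longleftrightarrow> u \<in> mons_in Z \<and> v \<in> mons_in Z"
  by (auto simp: mons_in_def keys_add_mon)

lemma zero_in_mons_in: "0 \<in> mons_in Z"
  by (simp add: mons_in_def)

lemma coord_in_mons_in: "coord i \<in> mons_in Z \<longleftrightarrow> i \<in> Z"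
  by (simp add: mons_in_def)

lemma mon_deg_eq_sum: "finite A \<Longrightarrow> keys u \<subseteq> A \<Longrightarrow> mon_deg u = (\<Sum>i\<in>A. lookup u i)"
  unfolding mon_deg_def by (rule sum.mono_neutral_left) (auto simp: in_keys_iff)

lemma mon_deg_add: "mon_deg (u + v) = mon_deg u + mon_deg v"
  by (simp add: mon_deg_eq_sum[of "keys u \<union> keys v"] keys_add_mon lookup_add sum.distrib)

lemma mon_deg_single: "mon_deg (single i c) = c"
  by (simp add: mon_deg_def)

lemma mon_deg_zero: "mon_deg 0 = 0"
  by (simp add: mon_deg_def)

lemma mon_deg_eq_0_iff: "mon_deg u = 0 \<longleftrightarrow> u = 0"
proof
  assume "mon_deg u = 0"
  then have "lookup u i = 0" if "i \<in> keys u" for i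
    using that by (simp add: mon_deg_def)
  then have "keys u = {}" using in_keys_iff by blast
  then show "u = 0" by (metis poly_mapping_sum_single sum.empty)
qed (simp add: mon_deg_zero)

text \<open>The source of lower bounds on degrees: it turns conditions on two exponents into degree
  at least 2. The sum is taken over \<open>keys u \<union> {i, j}\<close> because i and j need not
  occur in u.\<close>

lemma lookup_add_lookup_le_mon_deg:
  assumes "i \<noteq> j"
  shows "lookup u i + lookup u j \<le> mon_deg u"
proof -
  have "lookup u i + lookup u j = (\<Sum>k\<in>{i, j}. lookup u k)" using assms by simp
  also have "\<dots> \<le> (\<Sum>k\<in>keys u \<union> {i, j}. lookup u k)" by (rule sum_mono2) auto
  also have "\<dots> = mon_deg u" by (rule mon_deg_eq_sum[symmetric]) auto
  finally show ?thesis .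
qed

text \<open>Subtraction of exponents is truncated, so the quotient of two monomials is meaningful
  only under divisibility.\<close>

lemma mon_minus_add: "(\<And>i. lookup v i \<le> lookup u i) \<Longrightarrow> u = v + (u - v :: mon)"
  by (rule poly_mapping_eqI) (simp add: lookup_add lookup_minus)

lemma mons_in_minus: "u \<in> mons_in Z \<Longrightarrow> u - v \<in> mons_in Z"
  by (auto simp: mons_in_def in_keys_iff lookup_minus)

text \<open>The common form of the ideal, of each K[Z], of each Stanley space and of their graded
  pieces; it reduces questions about polynomials to sets of exponent vectors.\<close>

definition supported :: "mon set \<Rightarrow> 'k::field mpoly set" where
  "supported M = {f. keys f \<subseteq> M}"

lemma supported_mono: "M \<subseteq> N \<Longrightarrow> supported M \<subseteq> supported N"
  by (auto simp: supported_def)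

lemma polys_in_eq: "polys_in Z = supported (mons_in Z)"
  by (simp add: polys_in_def supported_def)

lemma zero_in_supported: "0 \<in> supported M"
  by (simp add: supported_def)

lemma add_in_supported: "f \<in> supported M \<Longrightarrow> g \<in> supported M \<Longrightarrow> f + g \<in> supported M"
  using keys_add[of f g] by (auto simp: supported_def)

lemma sum_in_supported: "(\<And>i. i \<in> A \<Longrightarrow> f i \<in> supported M) \<Longrightarrow> sum f A \<in> supported M"
  unfolding supported_def using keys_sum_subset[of A f M] by auto

lemma const_mult_in_supported: "f \<in> supported M \<Longrightarrow> const c * f \<in> supported M"
  using keys_const_mult[of c f] by (auto simp: supported_def)

lemma lookup_eq_0_of_supported: "f \<in> supported M \<Longrightarrow> u \<notin> M \<Longrightarrow> lookup f u = 0"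
  by (auto simp: supported_def in_keys_iff)

lemma single_in_supported: "u \<in> M \<Longrightarrow> single u c \<in> supported M"
  by (simp add: supported_def)

lemma monom_poly_in_supported: "monom_poly u \<in> (supported M :: 'k::field mpoly set) \<longleftrightarrow> u \<in> M"
  by (simp add: supported_def keys_monom_poly)

lemma mult_in_supported:
  assumes "f \<in> supported M" "g \<in> supported N" "\<And>u v. u \<in> M \<Longrightarrow> v \<in> N \<Longrightarrow> u + v \<in> L"
  shows "f * g \<in> supported L"
  using keys_mult[of f g] assms unfolding supported_def by blast

definition cone :: "mon \<times> nat set \<Rightarrow> mon set" where
  "cone p = (+) (fst p) ` mons_in (snd p)"

lemma cone_iff:
  "v \<in> cone (u, Z) \<longleftrightarrow>
     (\<forall>i\<in>Z. lookup u i \<le> lookup v i) \<and> (\<forall>i. i \<notin> Z \<longrightarrow> lookup v i = lookup u i)"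
proof
  assume "v \<in> cone (u, Z)"
  then show "(\<forall>i\<in>Z. lookup u i \<le> lookup v i) \<and> (\<forall>i. i \<notin> Z \<longrightarrow> lookup v i = lookup u i)"
    by (auto simp: cone_def mons_in_def lookup_add in_keys_iff)
next
  assume *: "(\<forall>i\<in>Z. lookup u i \<le> lookup v i) \<and> (\<forall>i. i \<notin> Z \<longrightarrow> lookup v i = lookup u i)"
  then have "v = u + (v - u)"
    by (intro mon_minus_add) (metis order_refl)
  moreover have "v - u \<in> mons_in Z"
    using * by (auto simp: mons_in_def in_keys_iff lookup_minus)
  ultimately show "v \<in> cone (u, Z)"
    by (auto simp: cone_def)
qed

lemma stanley_space_eq: "stanley_space p = (supported (cone p) :: 'k::field mpoly set)"
proof
  show "stanley_space p \<subseteq> (supported (cone p) :: 'k mpoly set)"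
    unfolding stanley_space_def polys_in_eq
  proof (rule image_subsetI)
    fix f :: "'k mpoly" assume "f \<in> supported (mons_in (snd p))"
    then show "monom_poly (fst p) * f \<in> supported (cone p)"
      by (rule mult_in_supported[OF iffD2[OF monom_poly_in_supported singletonI]])
        (auto simp: cone_def)
  qed
next
  show "supported (cone p) \<subseteq> (stanley_space p :: 'k mpoly set)"
  proof
    fix f :: "'k mpoly" assume f: "f \<in> supported (cone p)"
    \<comment> \<open>The quotient of f by the monomial \<open>fst p\<close>, formed term by term;
      every exponent of f lies in the cone, so nothing is truncated.\<close>
    define g where "g = (\<Sum>v\<in>keys f. single (v - fst p) (lookup f v))"
    have "g \<in> polys_in (snd p)"
      unfolding g_def polys_in_eq
      by (intro sum_in_supported single_in_supported)
        (use f in \<open>auto simp: supported_def cone_def\<close>)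
    moreover have "monom_poly (fst p) * g = (\<Sum>v\<in>keys f. single v (lookup f v))"
      unfolding g_def sum_distrib_left
      by (intro sum.cong) (use f in \<open>auto simp: supported_def cone_def monom_poly_def mult_single\<close>)
    ultimately show "f \<in> stanley_space p"
      unfolding stanley_space_def using poly_mapping_sum_single[of f] by auto
  qed
qed

lemma cring_poly_ring: "cring (poly_ring n :: 'k::field mpoly ring)"
proof (rule cringI)
  show "abelian_group (poly_ring n :: 'k mpoly ring)"
  proof (rule abelian_groupI)
    fix f g :: "'k mpoly" assume f: "f \<in> carrier (poly_ring n)"
    have "- f \<in> carrier (poly_ring n)"
      using f by (simp add: poly_ring_def polys_in_def subset_iff in_keys_iff)
    then show "\<exists>h\<in>carrier (poly_ring n). h \<oplus>\<^bsub>poly_ring n\<^esub> f = \<zero>\<^bsub>poly_ring n\<^esub>"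
      by (rule bexI[rotated]) (simp add: poly_ring_def)
    assume "g \<in> carrier (poly_ring n)"
    with f show "f \<oplus>\<^bsub>poly_ring n\<^esub> g \<in> carrier (poly_ring n)"
      by (simp add: poly_ring_def polys_in_eq add_in_supported)
  qed (simp_all add: poly_ring_def polys_in_eq zero_in_supported add_ac)
  have "f * g \<in> polys_in {1..n}" if "f \<in> polys_in {1..n}" "g \<in> polys_in {1..n}" for f g :: "'k mpoly"
    using that unfolding polys_in_eq by (rule mult_in_supported) (simp add: mons_in_add)
  then show "comm_monoid (poly_ring n :: 'k mpoly ring)"
    by (intro comm_monoidI)
      (simp_all add: poly_ring_def mult_ac, simp add: polys_in_def zero_in_mons_in)
qed (simp add: poly_ring_def algebra_simps)

text \<open>The multiples of A are closed under multiplication by monomials, so their span is an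
  ideal. It is the smallest one because each of its terms c x^(a + u) is the product of c x^u with
  the generator x^a.\<close>

lemma Idl_monom_poly:
  assumes "A \<subseteq> mons_in {1..n}"
  shows "Idl\<^bsub>poly_ring n\<^esub> (monom_poly ` A)
       = (supported {a + u | a u. a \<in> A \<and> u \<in> mons_in {1..n}} :: 'k::field mpoly set)"
    (is "_ = supported ?U")
proof -
  interpret cring "poly_ring n :: 'k mpoly ring" by (rule cring_poly_ring)
  have U: "?U \<subseteq> mons_in {1..n}"
    using assms by (auto simp: mons_in_add)
  have "A \<subseteq> ?U"
    using zero_in_mons_in by force
  have "ideal (supported ?U) (poly_ring n :: 'k mpoly ring)"
  proof (rule idealI)
    show "ring (poly_ring n :: 'k mpoly ring)" by (rule ring_axioms)
    show "subgroup (supported ?U) (add_monoid (poly_ring n :: 'k mpoly ring))"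
    proof (rule group.subgroupI)
      show "Group.group (add_monoid (poly_ring n :: 'k mpoly ring))" by (rule a_group)
      show "supported ?U \<subseteq> carrier (add_monoid (poly_ring n :: 'k mpoly ring))"
        using supported_mono[OF U] by (simp add: poly_ring_def polys_in_eq)
      show "supported ?U \<noteq> ({} :: 'k mpoly set)"
        using zero_in_supported by blast
      show "inv\<^bsub>add_monoid (poly_ring n)\<^esub> f \<in> supported ?U" if f: "f \<in> supported ?U" for f :: "'k mpoly"
      proof -
        \<comment> \<open>The inverse of the additive monoid is defined abstractly and has to be
          identified with the coefficientwise negative.\<close>
        have "f \<in> polys_in {1..n}"
          using f supported_mono[OF U] by (auto simp: polys_in_eq)
        then have "\<ominus>\<^bsub>poly_ring n\<^esub> f = - f"
          by (intro minus_equality) (auto simp: poly_ring_def polys_in_def in_keys_iff subset_iff)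
        moreover have "- f \<in> supported ?U"
          using f by (auto simp: supported_def in_keys_iff)
        ultimately show ?thesis by (simp add: a_inv_def)
      qed
      show "f \<otimes>\<^bsub>add_monoid (poly_ring n)\<^esub> g \<in> supported ?U"
        if "f \<in> supported ?U" "g \<in> supported ?U" for f g :: "'k mpoly"
        using add_in_supported[OF that] by (simp add: poly_ring_def)
    qed
    fix f g :: "'k mpoly"
    assume f: "f \<in> supported ?U" and g: "g \<in> carrier (poly_ring n)"
    have "f * g \<in> supported ?U"
    proof (rule mult_in_supported[OF f])
      show "g \<in> supported (mons_in {1..n})" using g by (simp add: poly_ring_def polys_in_eq)
      show "u + v \<in> ?U" if "u \<in> ?U" "v \<in> mons_in {1..n}" for u v
        using that by (force simp: add.assoc mons_in_add)
    qed
    then show "f \<otimes>\<^bsub>poly_ring n\<^esub> g \<in> supported ?U" "g \<otimes>\<^bsub>poly_ring n\<^esub> f \<in> supported ?U"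
      by (simp_all add: poly_ring_def mult.commute)
  qed
  moreover have "monom_poly ` A \<subseteq> (supported ?U :: 'k mpoly set)"
    using \<open>A \<subseteq> ?U\<close> by (auto simp: monom_poly_in_supported)
  moreover have "supported ?U \<subseteq> I" if I: "ideal I (poly_ring n)" "monom_poly ` A \<subseteq> I" for I :: "'k mpoly set"
  proof
    interpret I: ideal I "poly_ring n :: 'k mpoly ring" by (rule I(1))
    fix f :: "'k mpoly" assume "f \<in> supported ?U"
    have zero: "0 \<in> I" and add: "\<And>f g. f \<in> I \<Longrightarrow> g \<in> I \<Longrightarrow> f + g \<in> I"
      using I.zero_closed I.a_closed by (simp_all add: poly_ring_def)
    have single: "single v c \<in> I" if "v \<in> ?U" for v c
    proof -
      from that obtain a u where v: "v = a + u" "a \<in> A" "u \<in> mons_in {1..n}" by blast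
      have "single u c \<in> carrier (poly_ring n :: 'k mpoly ring)"
        using v by (simp add: poly_ring_def polys_in_def)
      then have "single u c \<otimes>\<^bsub>poly_ring n\<^esub> monom_poly a \<in> I"
        using I v by (intro I.I_l_closed) auto
      then show ?thesis
        by (simp add: poly_ring_def monom_poly_def mult_single v add.commute)
    qed
    have "(\<Sum>v\<in>B. single v (lookup f v)) \<in> I" if "finite B" "B \<subseteq> ?U" for B
      using that by (induction B rule: finite_induct) (simp_all add: zero add single)
    from this[of "keys f"] show "f \<in> I"
      using \<open>f \<in> supported ?U\<close>
      by (simp add: supported_def poly_mapping_sum_single[symmetric])
  qed
  ultimately show ?thesis
    unfolding genideal_def by blast
qed

section \<open>Stanley and Hilbert decompositions\<close>

text \<open>Everything is decided coefficient by coefficient: the sum reaches x^v iff some cone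
  contains v, and it determines its summands iff only one does. Indices rather than pairs must be
  unique, since a pair listed twice would already make the sum not direct.\<close>

lemma stanley_decomp_supported_iff:
  assumes M: "M \<subseteq> mons_in {1..n}"
  shows "stanley_decomp n (supported M :: 'k::field mpoly set) D \<longleftrightarrow>
    (\<forall>p\<in>set D. snd p \<subseteq> {1..n} \<and> cone p \<subseteq> M) \<and> (\<forall>v\<in>M. \<exists>!i. i < length D \<and> v \<in> cone (D ! i))"
    (is "?L \<longleftrightarrow> ?R")
proof
  assume L: ?L
  let ?P = "\<Pi>\<^sub>E i\<in>{..<length D}. supported (cone (D ! i)) :: 'k mpoly set"
  \<comment> \<open>The family with x^v in slot i and 0 in the others. If v lay in two cones, two
    such families would have the same sum.\<close>
  let ?e = "\<lambda>i v. \<lambda>j\<in>{..<length D}. if j = i then monom_poly v else (0 :: 'k mpoly)"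
  have bij: "bij_betw (\<lambda>w. \<Sum>i<length D. w i) ?P (supported M)"
    using L by (simp add: stanley_decomp_def stanley_space_eq)
  have e: "?e i v \<in> ?P" "(\<Sum>j<length D. ?e i v j) = monom_poly v"
    if "i < length D" "v \<in> cone (D ! i)" for i v
    using that by (auto simp: zero_in_supported monom_poly_in_supported sum.delta)
  have "cone (D ! i) \<subseteq> M" if "i < length D" for i
  proof
    fix v assume "v \<in> cone (D ! i)"
    from e[OF that this] bij_betwE[OF bij] have "monom_poly v \<in> (supported M :: 'k mpoly set)"
      by metis
    then show "v \<in> M" by (simp add: monom_poly_in_supported)
  qed
  then have "cone p \<subseteq> M" if "p \<in> set D" for p
    using that by (metis in_set_conv_nth)
  moreover have "snd p \<subseteq> {1..n}" if "p \<in> set D" for p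
    using bspec[OF conjunct1[OF L[unfolded stanley_decomp_def]] that] by (simp add: case_prod_unfold)
  moreover have "\<exists>i<length D. v \<in> cone (D ! i)" if v: "v \<in> M" for v
  proof -
    have "monom_poly v \<in> (\<lambda>w. \<Sum>i<length D. w i) ` ?P"
      using bij v by (simp add: bij_betw_def monom_poly_in_supported)
    then obtain w where w: "w \<in> ?P" "(\<Sum>i<length D. w i) = monom_poly v" by auto
    have "lookup (\<Sum>i<length D. w i) v \<noteq> 0"
      unfolding w by (simp add: monom_poly_def)
    then have "(\<Sum>i<length D. lookup (w i) v) \<noteq> 0"
      by (simp add: lookup_sum)
    then obtain i where "i < length D" "lookup (w i) v \<noteq> 0"
      by (meson lessThan_iff sum.not_neutral_contains_not_neutral)
    then show ?thesis
      using w(1) by (auto simp: PiE_iff supported_def in_keys_iff subset_iff)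
  qed
  moreover have "i = j"
    if "i < length D" "j < length D" "v \<in> cone (D ! i)" "v \<in> cone (D ! j)" for i j v
  proof -
    have "?e i v = ?e j v"
      using bij e[OF that(1,3)] e[OF that(2,4)] unfolding bij_betw_def inj_on_def by metis
    then have "?e i v i = ?e j v i" by metis
    then show "i = j"
      using that by (auto simp: monom_poly_neq_0 split: if_splits)
  qed
  ultimately show ?R by blast
next
  assume R: ?R
  let ?P = "\<Pi>\<^sub>E i\<in>{..<length D}. supported (cone (D ! i)) :: 'k mpoly set"
  have cone_M: "cone (D ! i) \<subseteq> M" if "i < length D" for i
    using R that by auto
  \<comment> \<open>Cutting the sum down to the i-th cone recovers the i-th summand, which yields
    injectivity.\<close>
  have lookup_w: "lookup (w i) v = (lookup (\<Sum>j<length D. w j) v when v \<in> cone (D ! i))"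
    if w: "w \<in> ?P" and i: "i < length D" for w i v
  proof (cases "v \<in> cone (D ! i)")
    case True
    have zero: "lookup (w j) v = 0" if "j < length D" "j \<noteq> i" for j
    proof -
      have "v \<notin> cone (D ! j)"
        using R True i that cone_M by blast
      moreover have "keys (w j) \<subseteq> cone (D ! j)"
        using w that by (auto simp: supported_def)
      ultimately show ?thesis
        by (auto simp: in_keys_iff subset_iff)
    qed
    have "(\<Sum>j<length D. lookup (w j) v) = lookup (w i) v"
      using i by (subst sum.remove[of _ i]) (auto simp: zero)
    then show ?thesis
      using True by (simp add: lookup_sum)
  next
    case False
    have "keys (w i) \<subseteq> cone (D ! i)"
      using w i by (auto simp: supported_def)
    with False show ?thesis
      by (auto simp: in_keys_iff subset_iff)
  qed
  have "inj_on (\<lambda>w. \<Sum>i<length D. w i) ?P"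
  proof (rule inj_onI)
    fix w w' assume w: "w \<in> ?P" "w' \<in> ?P" and eq: "(\<Sum>i<length D. w i) = (\<Sum>i<length D. w' i)"
    show "w = w'"
    proof (rule PiE_ext[OF w])
      fix i assume "i \<in> {..<length D}"
      then show "w i = w' i"
        by (intro poly_mapping_eqI) (simp add: lookup_w[OF w(1)] lookup_w[OF w(2)] eq)
    qed
  qed
  moreover have "(\<Sum>i<length D. w i) \<in> supported M" if w: "w \<in> ?P" for w
    using w subsetD[OF supported_mono[OF cone_M]] by (intro sum_in_supported) (auto simp: PiE_iff)
  moreover have "f \<in> (\<lambda>w. \<Sum>i<length D. w i) ` ?P" if f: "f \<in> supported M" for f
  proof
    define w where
      "w = (\<lambda>i\<in>{..<length D}. \<Sum>v\<in>keys f \<inter> cone (D ! i). single v (lookup f v))"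
    show "w \<in> ?P"
      by (auto simp: w_def intro!: sum_in_supported single_in_supported)
    have w_i: "lookup (w i) v = (lookup f v when v \<in> cone (D ! i))" if "i < length D" for i v
    proof -
      have "lookup (w i) v = (\<Sum>u\<in>keys f \<inter> cone (D ! i). if u = v then lookup f u else 0)"
        using that unfolding w_def by (auto simp: lookup_sum lookup_single when_def intro!: sum.cong)
      then show ?thesis
        by (auto simp: sum.delta when_def in_keys_iff)
    qed
    show "f = (\<Sum>i<length D. w i)"
    proof (rule poly_mapping_eqI)
      fix v
      show "lookup f v = lookup (\<Sum>i<length D. w i) v"
      proof (cases "v \<in> M")
        case True
        with R obtain i where i: "i < length D" "v \<in> cone (D ! i)"
          "\<And>j. j < length D \<Longrightarrow> v \<in> cone (D ! j) \<Longrightarrow> j = i"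
          by blast
        have "lookup (w j) v = 0" if "j < length D" "j \<noteq> i" for j
        proof -
          have "v \<notin> cone (D ! j)" using i(3) that by metis
          then show ?thesis using that by (simp add: w_i)
        qed
        then have "(\<Sum>j<length D. lookup (w j) v) = lookup (w i) v"
          using i(1) by (subst sum.remove[of _ i]) auto
        then show ?thesis
          using i(1,2) by (simp add: lookup_sum w_i)
      next
        case False
        then have "lookup f v = 0" using f by (auto simp: supported_def in_keys_iff)
        then show ?thesis
          by (simp add: lookup_sum w_i)
      qed
    qed
  qed
  ultimately have "bij_betw (\<lambda>w. \<Sum>i<length D. w i) ?P (supported M)"
    unfolding bij_betw_def by blast
  moreover have "u \<in> M" "Z \<subseteq> {1..n}" if "(u, Z) \<in> set D" for u Z
  proof -
    have "snd (u, Z) \<subseteq> {1..n} \<and> cone (u, Z) \<subseteq> M" using R that by blast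
    moreover have "u \<in> cone (u, Z)" by (simp add: cone_iff)
    ultimately show "u \<in> M" "Z \<subseteq> {1..n}" by auto
  qed
  ultimately show ?L
    using M unfolding stanley_decomp_def stanley_space_eq monom_poly_in_supported by blast
qed

text \<open>Listing P without repetition turns uniqueness of the pair into uniqueness of the
  index.\<close>

lemma stanley_decomp_of_partition:
  assumes "M \<subseteq> mons_in {1..n}" "finite P"
    and "\<And>p. p \<in> P \<Longrightarrow> snd p \<subseteq> {1..n} \<and> cone p \<subseteq> M"
    and "\<And>v. v \<in> M \<Longrightarrow> \<exists>!p. p \<in> P \<and> v \<in> cone p"
  obtains D where "set D = P" "stanley_decomp n (supported M :: 'k::field mpoly set) D"
proof -
  obtain D where D: "set D = P" "distinct D"
    using finite_distinct_list[OF assms(2)] by auto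
  have "\<exists>!i. i < length D \<and> v \<in> cone (D ! i)" if v: "v \<in> M" for v
  proof -
    from assms(4)[OF v] obtain p where p: "p \<in> set D" "v \<in> cone p"
      "\<And>q. q \<in> set D \<Longrightarrow> v \<in> cone q \<Longrightarrow> q = p"
      using D by auto
    from p(1) obtain i where "i < length D" "D ! i = p" by (auto simp: in_set_conv_nth)
    with p D(2) show ?thesis
      by (metis nth_eq_iff_index_eq nth_mem)
  qed
  then have "stanley_decomp n (supported M :: 'k mpoly set) D"
    using assms(3) D unfolding stanley_decomp_supported_iff[OF assms(1)] by blast
  with D(1) that show thesis by blast
qed

section \<open>Monomials of a given degree\<close>

definition mons_deg :: "nat set \<Rightarrow> nat \<Rightarrow> mon set" where
  "mons_deg Z d = {u \<in> mons_in Z. mon_deg u = d}"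

lemma coord_plus_minus: "i \<in> keys u \<Longrightarrow> coord i + (u - coord i) = (u :: mon)"
  by (rule mon_minus_add[symmetric]) (auto simp: lookup_single when_def in_keys_iff)

lemma mons_deg_0: "mons_deg Z 0 = {0}"
  using mon_deg_eq_0_iff zero_in_mons_in by (auto simp: mons_deg_def)

lemma finite_mons_deg:
  assumes "finite Z"
  shows "finite (mons_deg Z d)"
proof (induction d)
  case (Suc d)
  have "mons_deg Z (Suc d) \<subseteq> (\<Union>i\<in>Z. (+) (coord i) ` mons_deg Z d)"
  proof
    fix u assume u: "u \<in> mons_deg Z (Suc d)"
    then have "u \<noteq> 0" using mon_deg_zero by (auto simp: mons_deg_def)
    then obtain i where i: "i \<in> keys u" by (metis all_not_in_conv poly_mapping_sum_single sum.empty)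
    have "mon_deg (coord i + (u - coord i)) = Suc d"
      using u i coord_plus_minus by (simp add: mons_deg_def)
    then have "u - coord i \<in> mons_deg Z d"
      using u by (auto simp: mons_deg_def mon_deg_add mon_deg_single mons_in_minus)
    moreover have "i \<in> Z" using u i by (auto simp: mons_deg_def mons_in_def)
    ultimately show "u \<in> (\<Union>i\<in>Z. (+) (coord i) ` mons_deg Z d)"
      using coord_plus_minus[OF i] by force
  qed
  then show ?case
    using Suc assms finite_subset by blast
qed (simp add: mons_deg_0)

section \<open>Linear algebra over the coefficient field\<close>

interpretation mpoly: vector_space "\<lambda>c f. const c * f :: 'k::field mpoly"
proof
  fix a b :: 'k and x y :: "'k mpoly"
  show "const a * (x + y) = const a * x + const a * y" by (rule distrib_left)
  show "const (a + b) * x = const a * x + const b * x"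
    by (simp add: const_def single_add distrib_right)
  show "const a * (const b * x) = const (a * b) * x"
    by (simp add: const_def mult_single flip: mult.assoc)
  show "const 1 * x = x" by (simp add: const_def)
qed

lemma supported_span: "supported M \<subseteq> mpoly.span (monom_poly ` M)"
proof
  fix f :: "'k::field mpoly" assume f: "f \<in> supported M"
  have "(\<Sum>u\<in>keys f. const (lookup f u) * monom_poly u) \<in> mpoly.span (monom_poly ` M)"
    using f by (intro mpoly.span_sum mpoly.span_scale mpoly.span_base) (auto simp: supported_def)
  then show "f \<in> mpoly.span (monom_poly ` M)"
    by (simp add: const_mult_monom_poly flip: poly_mapping_sum_single)
qed

lemma inj_monom_poly: "inj_on (monom_poly :: _ \<Rightarrow> 'k::field mpoly) A"
  by (metis inj_onI keys_monom_poly singleton_inject)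

lemma lookup_sum_const_monom_poly:
  assumes "finite A"
  shows "lookup (\<Sum>u\<in>A. const (c u) * monom_poly u) v = (c v when v \<in> A)"
proof -
  have "lookup (\<Sum>u\<in>A. const (c u) * monom_poly u) v = (\<Sum>u\<in>A. if u = v then c u else 0)"
    unfolding lookup_sum const_mult_monom_poly
    by (intro sum.cong) (auto simp: lookup_single when_def)
  with assms show ?thesis by (simp add: when_def)
qed

lemma independent_monom_poly:
  assumes "finite A"
  shows "mpoly.independent (monom_poly ` A :: 'k::field mpoly set)"
proof (rule mpoly.independent_if_scalars_zero)
  fix c :: "'k mpoly \<Rightarrow> 'k" and x :: "'k mpoly"
  assume "(\<Sum>x\<in>monom_poly ` A. const (c x) * x) = 0" and x: "x \<in> monom_poly ` A"
  then have "(\<Sum>u\<in>A. const (c (monom_poly u)) * monom_poly u) = 0"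
    by (simp add: sum.reindex[OF inj_monom_poly])
  then have zero: "(c (monom_poly u) when u \<in> A) = 0" for u
    using lookup_sum_const_monom_poly[OF assms, of "\<lambda>u. c (monom_poly u)" u] by simp
  from x obtain u where "u \<in> A" "x = monom_poly u" by auto
  with zero[of u] show "c x = 0" by simp
qed (use assms in simp)

lemma supported_Int_homogeneous:
  "supported M \<inter> homogeneous d = supported {u \<in> M. mon_deg u = d}"
  by (auto simp: supported_def homogeneous_def)

text \<open>The pair (i, u) stands for the monomial u in the i-th summand.\<close>

definition hilbert_basis :: "(nat \<times> nat set) list \<Rightarrow> nat \<Rightarrow> (nat \<times> mon) set" where
  "hilbert_basis D d =
     (SIGMA i:{..<length D}. {u \<in> mons_in (snd (D ! i)). mon_deg u + fst (D ! i) = d})"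

text \<open>The case s > d is split off because the truncated \<open>d - s\<close> would then
  wrongly count the monomial 1.\<close>

lemma hilbert_basis_slice:
  "{u \<in> mons_in Z. mon_deg u + s = d} = (if s \<le> d then mons_deg Z (d - s) else {})"
  by (auto simp: mons_deg_def)

lemma finite_hilbert_basis:
  assumes "\<And>p. p \<in> set D \<Longrightarrow> finite (snd p)"
  shows "finite (hilbert_basis D d)"
  unfolding hilbert_basis_def hilbert_basis_slice
  using assms[OF nth_mem] by (intro finite_SigmaI) (auto intro!: finite_mons_deg)

lemma card_hilbert_basis:
  assumes "\<And>p. p \<in> set D \<Longrightarrow> finite (snd p)"
  shows "card (hilbert_basis D d) =
    (\<Sum>(s, Z)\<leftarrow>D. if s \<le> d then card (mons_deg Z (d - s)) else 0)"
proof -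
  have "card (hilbert_basis D d) =
      (\<Sum>i<length D. card {u \<in> mons_in (snd (D ! i)). mon_deg u + fst (D ! i) = d})"
    unfolding hilbert_basis_def hilbert_basis_slice
    using assms[OF nth_mem] by (intro card_SigmaI) (auto intro!: finite_mons_deg)
  then show ?thesis
    by (auto simp: sum_list_sum_nth hilbert_basis_slice case_prod_unfold lessThan_atLeast0
        intro!: sum.cong)
qed

text \<open>Both numbers are the dimension of the degree d component. The vector space at hand is
  that of polynomials, not of families of polynomials, so the monomial basis of the target is pulled
  back along \<open>\<phi>\<close> and compared with the monomials of M inside the source.\<close>

lemma card_hilbert_basis_of_graded_iso:
  fixes \<phi> :: "'k::field mpoly \<Rightarrow> nat \<Rightarrow> 'k mpoly"
  assumes iso: "graded_iso (supported M) D \<phi>"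
    and fin: "finite {u \<in> M. mon_deg u = d}" "\<And>p. p \<in> set D \<Longrightarrow> finite (snd p)"
  shows "card (hilbert_basis D d) = card {u \<in> M. mon_deg u = d}"
proof -
  let ?M = "{u \<in> M. mon_deg u = d}" and ?B = "hilbert_basis D d"
  \<comment> \<open>The basis vector of the target with the monomial \<open>snd x\<close> in slot
    \<open>fst x\<close>; \<open>g x\<close> below is its preimage under
    \<open>\<phi>\<close>.\<close>
  define e where "e x = (\<lambda>j. if j = fst x then monom_poly (snd x) else (0 :: 'k mpoly))" for x :: "nat \<times> mon"
  have inj: "inj_on \<phi> (supported M)"
    and add: "\<And>f g. f \<in> supported M \<Longrightarrow> g \<in> supported M \<Longrightarrow> \<phi> (f + g) = (\<lambda>i. \<phi> f i + \<phi> g i)"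
    and scale: "\<And>c f. f \<in> supported M \<Longrightarrow> \<phi> (const c * f) = (\<lambda>i. const c * \<phi> f i)"
    and comp: "\<phi> ` supported ?M = hilbert_component D d"
    using iso by (auto simp: graded_iso_def bij_betw_def supported_Int_homogeneous)
  have sub: "supported ?M \<subseteq> (supported M :: 'k mpoly set)"
    by (rule supported_mono) auto
  have finB: "finite ?B" by (rule finite_hilbert_basis) (rule fin)
  have zero: "\<phi> 0 = (\<lambda>i. 0)"
    using scale[of 0 0] by (simp add: zero_in_supported const_def)
  have "e x \<in> hilbert_component D d" if "x \<in> ?B" for x
    using that by (auto simp: e_def hilbert_component_def hilbert_space_def hilbert_basis_def
        polys_in_def keys_monom_poly)
  then have "e x \<in> \<phi> ` supported ?M" if "x \<in> ?B" for x
    using that unfolding comp .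
  then have "\<exists>f\<in>supported ?M. \<phi> f = e x" if "x \<in> ?B" for x
    using that unfolding image_iff by metis
  then obtain g where g: "\<And>x. x \<in> ?B \<Longrightarrow> g x \<in> supported ?M" "\<And>x. x \<in> ?B \<Longrightarrow> \<phi> (g x) = e x"
    by metis
  \<comment> \<open>Linearity of \<open>\<phi>\<close> is known only on the ideal, so each partial
    sum must be kept inside it.\<close>
  have lin: "(\<Sum>x\<in>X. const (c x) * g x) \<in> supported M \<and>
      \<phi> (\<Sum>x\<in>X. const (c x) * g x) = (\<lambda>j. \<Sum>x\<in>X. const (c x) * e x j)"
    if "X \<subseteq> ?B" for X c
    using finite_subset[OF that finB] that
  proof (induction X rule: finite_induct)
    case (insert x X)
    then have "g x \<in> supported M" using g(1) sub by blast
    with insert show ?case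
      by (simp add: add scale g add_in_supported const_mult_in_supported)
  qed (simp add: zero zero_in_supported)
  have coeff: "lookup (\<Sum>x\<in>?B. const (c x) * e x j) v = (c (j, v) when (j, v) \<in> ?B)" for c j v
  proof -
    have "lookup (\<Sum>x\<in>?B. const (c x) * e x j) v = (\<Sum>x\<in>?B. if x = (j, v) then c x else 0)"
      unfolding lookup_sum
      by (intro sum.cong) (auto simp: e_def lookup_const_mult monom_poly_def lookup_single when_def)
    then show ?thesis
      using finB by (simp add: when_def)
  qed
  have inj_e: "x = y" if "e x = e y" for x y
  proof -
    have "e x (fst x) = e y (fst x)" using that by simp
    then have "fst x = fst y" "(monom_poly (snd x) :: 'k mpoly) = monom_poly (snd y)"
      by (auto simp: e_def monom_poly_neq_0 split: if_splits)
    then show ?thesis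
      using inj_monom_poly[of UNIV] by (auto simp: prod_eq_iff dest: injD)
  qed
  then have inj_g: "inj_on g ?B"
    by (metis g(2) inj_onI)
  have "mpoly.independent (g ` ?B)"
  proof (rule mpoly.independent_if_scalars_zero)
    fix c :: "'k mpoly \<Rightarrow> 'k" and y :: "'k mpoly"
    assume "(\<Sum>y\<in>g ` ?B. const (c y) * y) = 0" and y: "y \<in> g ` ?B"
    then have "(\<Sum>x\<in>?B. const (c (g x)) * g x) = 0"
      by (simp add: sum.reindex[OF inj_g])
    then have "(\<Sum>x\<in>?B. const (c (g x)) * e x j) = 0" for j
      using lin[of ?B "\<lambda>x. c (g x)"] zero by (auto simp: fun_eq_iff)
    then have zero: "(c (g (j, v)) when (j, v) \<in> ?B) = 0" for j v
      using coeff[of "\<lambda>x. c (g x)" j v] by simp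
    from y obtain j v where "(j, v) \<in> ?B" "y = g (j, v)" by auto
    with zero[of j v] show "c y = 0" by simp
  qed (use finB in simp)
  moreover have "g ` ?B \<subseteq> mpoly.span (monom_poly ` ?M)"
    using g(1) supported_span by blast
  ultimately have "card (g ` ?B) \<le> card (monom_poly ` ?M :: 'k mpoly set)"
    using mpoly.independent_span_bound fin(1) by blast
  \<comment> \<open>Conversely, the image of a monomial is expanded in the vectors
    \<open>e x\<close>; injectivity of \<open>\<phi>\<close> carries the expansion back to the
    \<open>g x\<close>.\<close>
  moreover have "monom_poly ` ?M \<subseteq> mpoly.span (g ` ?B)"
  proof (rule image_subsetI)
    fix u assume u: "u \<in> ?M"
    let ?f = "monom_poly u :: 'k mpoly"
    let ?c = "\<lambda>x. lookup (\<phi> ?f (fst x)) (snd x)"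
    have "?f \<in> supported ?M" using u by (simp add: monom_poly_in_supported)
    then have "\<phi> ?f \<in> hilbert_component D d" using comp by blast
    then have "lookup (\<phi> ?f j) v = 0" if "(j, v) \<notin> ?B" for j v
      using that by (cases "j < length D")
        (auto simp: hilbert_component_def hilbert_space_def hilbert_basis_def polys_in_def
          in_keys_iff subset_iff Ball_def)
    then have "\<phi> ?f = (\<lambda>j. \<Sum>x\<in>?B. const (?c x) * e x j)"
      by (intro ext poly_mapping_eqI) (auto simp only: coeff when_def fst_conv snd_conv split: if_split)
    also have "\<dots> = \<phi> (\<Sum>x\<in>?B. const (?c x) * g x)"
      using lin[of ?B ?c] by simp
    finally have "?f = (\<Sum>x\<in>?B. const (?c x) * g x)"
      using inj lin[of ?B ?c] \<open>?f \<in> supported ?M\<close> sub by (auto dest: inj_onD)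
    moreover have "(\<Sum>x\<in>?B. const (?c x) * g x) \<in> mpoly.span (g ` ?B)"
      by (intro mpoly.span_sum mpoly.span_scale mpoly.span_base) auto
    ultimately show "?f \<in> mpoly.span (g ` ?B)" by (simp only:)
  qed
  then have "card (monom_poly ` ?M :: 'k mpoly set) \<le> card (g ` ?B)"
    using mpoly.independent_span_bound[OF _ independent_monom_poly[OF fin(1)]] finB by blast
  ultimately show ?thesis
    by (simp add: card_image inj_g inj_monom_poly)
qed

text \<open>Equal dimensions give a bijection between the two monomial bases in every degree. Glued
  together, these form a degree-preserving bijection of bases, along which \<open>\<phi>\<close>
  transports coefficients.\<close>

lemma graded_iso_of_card_hilbert_basis:
  assumes fin: "\<And>d. finite {u \<in> M. mon_deg u = d}" "\<And>p. p \<in> set D \<Longrightarrow> finite (snd p)"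
    and card: "\<And>d. card (hilbert_basis D d) = card {u \<in> M. mon_deg u = d}"
  shows "\<exists>\<phi>. graded_iso (supported M :: 'k::field mpoly set) D \<phi>"
proof -
  define B where "B = (SIGMA i:{..<length D}. mons_in (snd (D ! i)))"
  define deg where "deg x = mon_deg (snd x) + fst (D ! fst x)" for x
  have B_d: "hilbert_basis D d = {x \<in> B. deg x = d}" for d
    by (auto simp: B_def deg_def hilbert_basis_def)
  have "\<forall>d. \<exists>h. bij_betw h {x \<in> B. deg x = d} {u \<in> M. mon_deg u = d}"
    unfolding B_d[symmetric]
    using finite_hilbert_basis[OF fin(2)] fin(1) card by (intro allI finite_same_card_bij) auto
  from choice[OF this] obtain h
    where h: "\<And>d. bij_betw (h d) {x \<in> B. deg x = d} {u \<in> M. mon_deg u = d}"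
    by blast
  \<comment> \<open>Each x is mapped by the bijection of its own degree; the degree of the image
    reveals which one was used, so the glued map stays injective.\<close>
  define \<gamma> where "\<gamma> x = h (deg x) x" for x
  have \<gamma>: "\<gamma> x \<in> M" "mon_deg (\<gamma> x) = deg x" if "x \<in> B" for x
    using bspec[OF bij_betwE[OF h, of "deg x"], of x] that by (simp_all add: \<gamma>_def)
  have inj_\<gamma>: "inj_on \<gamma> B"
  proof (rule inj_onI)
    fix x y assume xy: "x \<in> B" "y \<in> B" "\<gamma> x = \<gamma> y"
    then have "deg x = deg y" using \<gamma>(2) by metis
    then show "x = y"
      using xy inj_onD[OF bij_betw_imp_inj_on[OF h, of "deg x"], of x y] by (simp add: \<gamma>_def)
  qed
  have surj_\<gamma>: "\<exists>x\<in>B. \<gamma> x = u" if "u \<in> M" for u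
  proof -
    have "u \<in> h (mon_deg u) ` {x \<in> B. deg x = mon_deg u}"
      using h[of "mon_deg u"] that by (simp add: bij_betw_def)
    then obtain x where "x \<in> B" "deg x = mon_deg u" "u = h (mon_deg u) x" by blast
    then show ?thesis by (intro bexI[of _ x]) (simp_all add: \<gamma>_def)
  qed
  define \<phi> :: "'k mpoly \<Rightarrow> nat \<Rightarrow> 'k mpoly" where
    "\<phi> f i = Abs_poly_mapping (\<lambda>u. lookup f (\<gamma> (i, u)) when (i, u) \<in> B)" for f i
  \<comment> \<open>\<open>Abs_poly_mapping\<close> is meaningful only for finite support, which
    holds because the injective \<open>\<gamma>\<close> pulls the finite set \<open>keys f\<close>
    back to a finite set.\<close>
  have lookup_\<phi>: "lookup (\<phi> f i) u = (lookup f (\<gamma> (i, u)) when (i, u) \<in> B)" for f i u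
  proof -
    have "finite (\<gamma> -` keys f \<inter> B)"
      using inj_\<gamma> by (intro finite_vimage_IntI) auto
    moreover have "{u. (lookup f (\<gamma> (i, u)) when (i, u) \<in> B) \<noteq> 0} \<subseteq> snd ` (\<gamma> -` keys f \<inter> B)"
      by (force simp: in_keys_iff)
    ultimately have "finite {u. (lookup f (\<gamma> (i, u)) when (i, u) \<in> B) \<noteq> 0}"
      using finite_surj by blast
    then show ?thesis
      unfolding \<phi>_def by simp
  qed
  have \<phi>_space: "\<phi> f \<in> hilbert_space D" for f
    by (auto simp: hilbert_space_def polys_in_def in_keys_iff lookup_\<phi> B_def
        intro!: poly_mapping_eqI)
  have inj: "inj_on \<phi> (supported M)"
  proof (rule inj_onI)
    fix f g assume f: "f \<in> supported M" and g: "g \<in> supported M" and eq: "\<phi> f = \<phi> g"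
    show "f = g"
    proof (rule poly_mapping_eqI)
      fix u
      show "lookup f u = lookup g u"
      proof (cases "u \<in> M")
        case True
        from surj_\<gamma>[OF True] obtain i v where "(i, v) \<in> B" "\<gamma> (i, v) = u" by auto
        then show ?thesis
          using lookup_\<phi>[of f i v] lookup_\<phi>[of g i v] eq by simp
      next
        case False
        then show ?thesis using f g by (simp add: lookup_eq_0_of_supported)
      qed
    qed
  qed
  have surj: "\<exists>f\<in>supported M. \<phi> f = w" if w: "w \<in> hilbert_space D" for w
  proof -
    define X where "X = (SIGMA i:{..<length D}. keys (w i))"
    have XB: "X \<subseteq> B" and finX: "finite X"
      using w by (auto simp: X_def B_def hilbert_space_def polys_in_def)
    \<comment> \<open>The preimage of w: the term of w at (i, u) is moved to the monomial
      \<open>\<gamma> (i, u)\<close>.\<close>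
    define f where "f = (\<Sum>x\<in>X. single (\<gamma> x) (lookup (w (fst x)) (snd x)))"
    have "f \<in> supported M"
      unfolding f_def using XB \<gamma>(1) by (intro sum_in_supported single_in_supported) auto
    moreover have "lookup (\<phi> f i) u = lookup (w i) u" for i u
    proof (cases "(i, u) \<in> B")
      case True
      have "lookup f (\<gamma> (i, u)) = (\<Sum>x\<in>X. if x = (i, u) then lookup (w (fst x)) (snd x) else 0)"
        unfolding f_def lookup_sum
        using True XB inj_\<gamma> by (intro sum.cong) (auto simp: lookup_single when_def dest: inj_onD)
      also have "\<dots> = lookup (w i) u"
        using True finX by (auto simp: X_def B_def in_keys_iff)
      finally show ?thesis using True by (simp add: lookup_\<phi>)
    next
      case False
      then have "lookup (w i) u = 0"
        using w by (cases "i < length D")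
          (auto simp: B_def hilbert_space_def polys_in_def in_keys_iff subset_iff)
      with False show ?thesis by (simp add: lookup_\<phi>)
    qed
    then have "\<phi> f = w" by (intro ext poly_mapping_eqI)
    ultimately show ?thesis by blast
  qed
  have deg_\<phi>: "\<phi> f \<in> hilbert_component D d \<longleftrightarrow> f \<in> homogeneous d" if f: "f \<in> supported M" for f d
  proof
    assume comp: "\<phi> f \<in> hilbert_component D d"
    have "mon_deg u = d" if u: "u \<in> keys f" for u
    proof -
      have "u \<in> M" using u f by (auto simp: supported_def)
      from surj_\<gamma>[OF this] obtain i v where iv: "(i, v) \<in> B" "\<gamma> (i, v) = u" by auto
      then have "v \<in> keys (\<phi> f i)" using u by (simp add: in_keys_iff lookup_\<phi>)
      then have "deg (i, v) = d"
        using comp iv by (auto simp: hilbert_component_def deg_def B_def)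
      then show ?thesis using iv \<gamma>(2) by metis
    qed
    then show "f \<in> homogeneous d" by (simp add: homogeneous_def)
  next
    assume "f \<in> homogeneous d"
    then have "mon_deg u + fst (D ! i) = d" if "u \<in> keys (\<phi> f i)" for i u
      using that \<gamma>(2)[of "(i, u)"]
      by (auto simp: homogeneous_def in_keys_iff lookup_\<phi> deg_def)
    then show "\<phi> f \<in> hilbert_component D d"
      using \<phi>_space by (auto simp: hilbert_component_def)
  qed
  have "bij_betw \<phi> (supported M) (hilbert_space D)"
    using inj \<phi>_space surj unfolding bij_betw_def by blast
  moreover have "\<phi> (f + g) = (\<lambda>i. \<phi> f i + \<phi> g i)" for f g
    by (intro ext poly_mapping_eqI) (simp add: lookup_\<phi> lookup_add when_def)
  moreover have "\<phi> (const c * f) = (\<lambda>i. const c * \<phi> f i)" for c f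
    by (intro ext poly_mapping_eqI) (simp add: lookup_\<phi> lookup_const_mult when_def)
  moreover have "\<phi> ` (supported M \<inter> homogeneous d) = hilbert_component D d" for d
  proof
    show "\<phi> ` (supported M \<inter> homogeneous d) \<subseteq> hilbert_component D d"
      using deg_\<phi> by blast
    show "hilbert_component D d \<subseteq> \<phi> ` (supported M \<inter> homogeneous d)"
      using deg_\<phi> surj unfolding hilbert_component_def by blast
  qed
  ultimately show ?thesis
    unfolding graded_iso_def by blast
qed

section \<open>Interval partitions\<close>

text \<open>Intervals are taken with respect to inclusion. Their tops become the variable sets of
  Stanley spaces, which is why k bounds the size of the tops alone.\<close>

definition interval_partitionable :: "nat \<Rightarrow> 'a set set \<Rightarrow> bool" where
  "interval_partitionable k F \<longleftrightarrow>
     (\<exists>Q. finite Q \<and> (\<forall>p\<in>Q. fst p \<subseteq> snd p \<and> k \<le> card (snd p)) \<and>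
        (\<forall>S\<in>F. \<exists>!p. p \<in> Q \<and> S \<in> {fst p..snd p}) \<and> (\<forall>p\<in>Q. {fst p..snd p} \<subseteq> F))"

lemma interval_partitionable_mono:
  assumes "interval_partitionable k F" "j \<le> k"
  shows "interval_partitionable j F"
proof -
  obtain Q where "finite Q" "\<forall>p\<in>Q. fst p \<subseteq> snd p \<and> k \<le> card (snd p)"
    "\<forall>S\<in>F. \<exists>!p. p \<in> Q \<and> S \<in> {fst p..snd p}" "\<forall>p\<in>Q. {fst p..snd p} \<subseteq> F"
    using assms(1) unfolding interval_partitionable_def by blast
  with assms(2) show ?thesis
    unfolding interval_partitionable_def by (intro exI[of _ Q]) auto
qed

lemma interval_partitionable_Un:
  assumes "interval_partitionable k F" "interval_partitionable k F'" "F \<inter> F' = {}"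
  shows "interval_partitionable k (F \<union> F')"
proof -
  obtain Q where Q: "finite Q" "\<forall>p\<in>Q. fst p \<subseteq> snd p \<and> k \<le> card (snd p)"
    "\<forall>S\<in>F. \<exists>!p. p \<in> Q \<and> S \<in> {fst p..snd p}" "\<forall>p\<in>Q. {fst p..snd p} \<subseteq> F"
    using assms(1) unfolding interval_partitionable_def by blast
  obtain Q' where Q': "finite Q'" "\<forall>p\<in>Q'. fst p \<subseteq> snd p \<and> k \<le> card (snd p)"
    "\<forall>S\<in>F'. \<exists>!p. p \<in> Q' \<and> S \<in> {fst p..snd p}" "\<forall>p\<in>Q'. {fst p..snd p} \<subseteq> F'"
    using assms(2) unfolding interval_partitionable_def by blast
  have "\<exists>!p. p \<in> Q \<union> Q' \<and> S \<in> {fst p..snd p}" if "S \<in> F \<union> F'" for S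
  proof (cases "S \<in> F")
    case True
    then have "p \<notin> Q' \<or> S \<notin> {fst p..snd p}" for p using Q'(4) assms(3) by blast
    then show ?thesis using Q(3) True by (metis Un_iff)
  next
    case False
    then have "S \<in> F'" and "p \<notin> Q \<or> S \<notin> {fst p..snd p}" for p using Q(4) that by blast+
    then show ?thesis using Q'(3) by (metis Un_iff)
  qed
  then show ?thesis
    unfolding interval_partitionable_def using Q Q' by (intro exI[of _ "Q \<union> Q'"]) auto
qed

text \<open>A subset of the disjoint union is a pair of subsets, and the product of two intervals is
  again an interval, whose top is the disjoint union of the two tops; so the sizes of the tops
  add.\<close>

lemma interval_partitionable_prod:
  assumes "interval_partitionable k F" "interval_partitionable k' F'"
    and V: "F \<subseteq> Pow V" "F' \<subseteq> Pow V'" "V \<inter> V' = {}" "finite V" "finite V'"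
  shows "interval_partitionable (k + k') {S. S \<subseteq> V \<union> V' \<and> S \<inter> V \<in> F \<and> S \<inter> V' \<in> F'}"
    (is "interval_partitionable _ ?F")
proof -
  obtain Q where Q: "finite Q" "\<forall>p\<in>Q. fst p \<subseteq> snd p \<and> k \<le> card (snd p)"
    "\<forall>S\<in>F. \<exists>!p. p \<in> Q \<and> S \<in> {fst p..snd p}" "\<forall>p\<in>Q. {fst p..snd p} \<subseteq> F"
    using assms(1) unfolding interval_partitionable_def by blast
  obtain Q' where Q': "finite Q'" "\<forall>p\<in>Q'. fst p \<subseteq> snd p \<and> k' \<le> card (snd p)"
    "\<forall>S\<in>F'. \<exists>!p. p \<in> Q' \<and> S \<in> {fst p..snd p}" "\<forall>p\<in>Q'. {fst p..snd p} \<subseteq> F'"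
    using assms(2) unfolding interval_partitionable_def by blast
  let ?u = "\<lambda>(p, q). (fst p \<union> fst q, snd p \<union> snd q)"
  let ?R = "?u ` (Q \<times> Q')"
  have sub: "snd p \<subseteq> V" if "p \<in> Q" for p
  proof -
    have "snd p \<in> {fst p..snd p}" using Q(2) that by simp
    then show ?thesis using Q(4) V(1) that by blast
  qed
  have sub': "snd p \<subseteq> V'" if "p \<in> Q'" for p
  proof -
    have "snd p \<in> {fst p..snd p}" using Q'(2) that by simp
    then show ?thesis using Q'(4) V(2) that by blast
  qed
  have mem: "S \<in> {fst (?u (p, q))..snd (?u (p, q))} \<longleftrightarrow>
      S \<subseteq> V \<union> V' \<and> S \<inter> V \<in> {fst p..snd p} \<and> S \<inter> V' \<in> {fst q..snd q}"
    if "p \<in> Q" "q \<in> Q'" for S p q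
  proof -
    have "fst p \<subseteq> V" "snd p \<subseteq> V" "fst q \<subseteq> V'" "snd q \<subseteq> V'"
      using sub[OF that(1)] sub'[OF that(2)] Q(2) Q'(2) that by blast+
    then show ?thesis using V(3) by auto
  qed
  have ex1: "\<exists>!r. r \<in> ?R \<and> S \<in> {fst r..snd r}" if S: "S \<in> ?F" for S
  proof -
    obtain p where p: "p \<in> Q" "S \<inter> V \<in> {fst p..snd p}"
      "\<And>p'. p' \<in> Q \<Longrightarrow> S \<inter> V \<in> {fst p'..snd p'} \<Longrightarrow> p' = p"
      using Q(3) S by blast
    obtain q where q: "q \<in> Q'" "S \<inter> V' \<in> {fst q..snd q}"
      "\<And>q'. q' \<in> Q' \<Longrightarrow> S \<inter> V' \<in> {fst q'..snd q'} \<Longrightarrow> q' = q"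
      using Q'(3) S by blast
    show ?thesis
    proof (rule ex1I)
      show "?u (p, q) \<in> ?R \<and> S \<in> {fst (?u (p, q))..snd (?u (p, q))}"
        using p(1,2) q(1,2) S mem[OF p(1) q(1)] by blast
      fix r assume r: "r \<in> ?R \<and> S \<in> {fst r..snd r}"
      then obtain p' q' where pq: "p' \<in> Q" "q' \<in> Q'" "r = ?u (p', q')" by blast
      then have "S \<inter> V \<in> {fst p'..snd p'}" "S \<inter> V' \<in> {fst q'..snd q'}"
        using r mem[OF pq(1,2), of S] by simp_all
      then have "p' = p" "q' = q"
        using p(3) q(3) pq(1,2) by blast+
      with pq(3) show "r = ?u (p, q)" by simp
    qed
  qed
  have le: "fst r \<subseteq> snd r \<and> k + k' \<le> card (snd r)" if "r \<in> ?R" for r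
  proof -
    obtain p q where pq: "p \<in> Q" "q \<in> Q'" "r = ?u (p, q)" using \<open>r \<in> ?R\<close> by blast
    have fin: "finite (snd p)" "finite (snd q)" "snd p \<inter> snd q = {}"
      using sub[OF pq(1)] sub'[OF pq(2)] V finite_subset by blast+
    have "fst p \<subseteq> snd p" "fst q \<subseteq> snd q" "k \<le> card (snd p)" "k' \<le> card (snd q)"
      using Q(2) Q'(2) pq by simp_all
    then show ?thesis
      using pq(3) fin by (auto simp: card_Un_disjoint)
  qed
  have sub_F: "{fst r..snd r} \<subseteq> ?F" if "r \<in> ?R" for r
  proof
    fix S assume S: "S \<in> {fst r..snd r}"
    obtain p q where pq: "p \<in> Q" "q \<in> Q'" "r = ?u (p, q)" using \<open>r \<in> ?R\<close> by blast
    from S have "S \<subseteq> V \<union> V'" "S \<inter> V \<in> {fst p..snd p}" "S \<inter> V' \<in> {fst q..snd q}"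
      unfolding pq(3) mem[OF pq(1,2)] by blast+
    then show "S \<in> ?F"
      using Q(4) Q'(4) pq(1,2) by blast
  qed
  show ?thesis
    unfolding interval_partitionable_def
  proof (intro exI[of _ ?R] conjI ballI)
    show "finite ?R" using Q(1) Q'(1) by simp
  qed (use ex1 le sub_F in \<open>simp_all only:\<close>)
qed

lemma interval_partitionable_Pow: "interval_partitionable (card V) (Pow V)"
  unfolding interval_partitionable_def by (intro exI[of _ "{({}, V)}"]) auto

text \<open>Cyclically, each singleton is joined to the pair formed with its successor. This uses up
  all singletons and pairs, and the full triple is left as an interval of its own.\<close>

lemma interval_partitionable_triple:
  assumes "a \<noteq> b" "b \<noteq> c" "c \<noteq> a"
  shows "interval_partitionable 2 (Pow {a, b, c} - {{}})"
proof -
  let ?Q = "{({a}, {a, b}), ({b}, {b, c}), ({c}, {a, c}), ({a, b, c}, {a, b, c})}"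
  have "\<exists>!p. p \<in> ?Q \<and> S \<in> {fst p..snd p}" if S: "S \<in> Pow {a, b, c} - {{}}" for S
  proof -
    have neq: "b \<noteq> a" "c \<noteq> b" "a \<noteq> c" using assms by auto
    from S consider "S = {a} \<or> S = {a, b}" | "S = {b} \<or> S = {b, c}" | "S = {c} \<or> S = {a, c}"
      | "S = {a, b, c}"
      by (auto simp: Pow_insert)
    then show ?thesis
    proof cases
      case 1
      then show ?thesis
        using assms neq by (intro ex1I[of _ "({a}, {a, b})"]) auto
    next
      case 2
      then show ?thesis
        using assms neq by (intro ex1I[of _ "({b}, {b, c})"]) auto
    next
      case 3
      then show ?thesis
        using assms neq by (intro ex1I[of _ "({c}, {a, c})"]) auto
    next
      case 4
      then show ?thesis
        using assms neq by (intro ex1I[of _ "({a, b, c}, {a, b, c})"]) auto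
    qed
  qed
  moreover have "{fst p..snd p} \<subseteq> Pow {a, b, c} - {{}}" if "p \<in> ?Q" for p
    using that by auto
  ultimately show ?thesis
    unfolding interval_partitionable_def using assms
    by (intro exI[of _ ?Q]) (auto simp: card_insert_if)
qed

text \<open>Arrange the blocks V1, V2, V3 in a cycle. A nonempty set missing some block meets exactly one
  Vi whose predecessor it misses; on these sets the intervals for Vi are multiplied with all subsets
  of the next block (2 + 3), and on the sets meeting all blocks the three factors give 2 + 2 + 2.\<close>

lemma interval_partitionable_nonempty_subsets:
  fixes V1 V2 V3 :: "'a set"
  assumes "interval_partitionable 2 (Pow V1 - {{}})" "interval_partitionable 2 (Pow V2 - {{}})"
    "interval_partitionable 2 (Pow V3 - {{}})"
    and fin: "finite V1" "finite V2" "finite V3" and card: "card V1 = 3" "card V2 = 3" "card V3 = 3"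
    and disj: "V1 \<inter> V2 = {}" "V2 \<inter> V3 = {}" "V3 \<inter> V1 = {}"
  shows "interval_partitionable 5 (Pow (V1 \<union> V2 \<union> V3) - {{}})"
proof -
  \<comment> \<open>For consecutive blocks V and W: the sets that meet V and miss the predecessor of
    V, the remaining block.\<close>
  define F where "F V W = {S. S \<subseteq> V \<union> W \<and> S \<inter> V \<in> Pow V - {{}} \<and> S \<inter> W \<in> Pow W}" for V W :: "'a set"
  define E where "E = {S. S \<subseteq> V1 \<union> V2 \<and> S \<inter> V1 \<in> Pow V1 - {{}} \<and> S \<inter> V2 \<in> Pow V2 - {{}}}"
  define E3 where "E3 = {S. S \<subseteq> (V1 \<union> V2) \<union> V3 \<and> S \<inter> (V1 \<union> V2) \<in> E \<and> S \<inter> V3 \<in> Pow V3 - {{}}}"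
  have F: "interval_partitionable 5 (F V W)"
    if "interval_partitionable 2 (Pow V - {{}})" "finite V" "finite W" "card W = 3" "V \<inter> W = {}" for V W
    using interval_partitionable_prod[OF that(1) interval_partitionable_Pow[of W] _ _ that(5,2,3)] that(4)
    unfolding F_def by auto
  have "interval_partitionable (2 + 2) E"
    unfolding E_def using assms by (intro interval_partitionable_prod) auto
  then have "interval_partitionable (2 + 2 + 2) E3"
    unfolding E3_def using assms by (intro interval_partitionable_prod) (auto simp: E_def)
  then have "interval_partitionable 5 E3"
    by (rule interval_partitionable_mono) simp
  then have "interval_partitionable 5 (((F V1 V2 \<union> F V2 V3) \<union> F V3 V1) \<union> E3)"
    using assms disj by (intro interval_partitionable_Un F) (auto simp: F_def E3_def E_def)
  moreover have "((F V1 V2 \<union> F V2 V3) \<union> F V3 V1) \<union> E3 = Pow (V1 \<union> V2 \<union> V3) - {{}}"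
  proof -
    have "S \<in> ((F V1 V2 \<union> F V2 V3) \<union> F V3 V1) \<union> E3"
      if S: "S \<subseteq> V1 \<union> V2 \<union> V3" "S \<noteq> {}" for S
    proof -
      have F_iff: "S \<in> F V W \<longleftrightarrow> S \<subseteq> V \<union> W \<and> S \<inter> V \<noteq> {}" for V W
        by (simp add: F_def)
      have "S \<in> E3 \<longleftrightarrow> S \<inter> V1 \<noteq> {} \<and> S \<inter> V2 \<noteq> {} \<and> S \<inter> V3 \<noteq> {}"
        using S(1) by (auto simp: E3_def E_def)
      moreover have "S \<subseteq> V1 \<union> V2 \<longleftrightarrow> S \<inter> V3 = {}" "S \<subseteq> V2 \<union> V3 \<longleftrightarrow> S \<inter> V1 = {}"
        "S \<subseteq> V3 \<union> V1 \<longleftrightarrow> S \<inter> V2 = {}"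
        using S(1) disj by blast+
      moreover have "S \<inter> V1 \<noteq> {} \<or> S \<inter> V2 \<noteq> {} \<or> S \<inter> V3 \<noteq> {}"
        using S by blast
      \<comment> \<open>By now membership in each family depends only on which of the three blocks S
        meets, so the claim is propositional.\<close>
      ultimately show ?thesis unfolding Un_iff F_iff by argo
    qed
    moreover have "((F V1 V2 \<union> F V2 V3) \<union> F V3 V1) \<union> E3 \<subseteq> Pow (V1 \<union> V2 \<union> V3) - {{}}"
      by (auto simp: F_def E3_def)
    ultimately show ?thesis by blast
  qed
  ultimately show ?thesis by simp
qed

lemma interval_partitionable_2_to_10: "interval_partitionable 5 (Pow {2..10::nat} - {{}})"
proof -
  have "interval_partitionable 5 (Pow ({2, 3, 4} \<union> {5, 6, 7} \<union> {8, 9, 10 :: nat}) - {{}})"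
    by (intro interval_partitionable_nonempty_subsets interval_partitionable_triple) auto
  moreover have "{2, 3, 4} \<union> {5, 6, 7} \<union> {8, 9, 10} = {2..10::nat}" by auto
  ultimately show ?thesis by simp
qed

section \<open>Hilbert functions\<close>

lemma mon_deg_cone: "{v \<in> cone (u, Z). mon_deg v = d} =
    (if mon_deg u \<le> d then (+) u ` mons_deg Z (d - mon_deg u) else {})"
  by (auto simp: cone_def mons_deg_def mon_deg_add image_iff)

lemma card_cone_deg: "card {v \<in> cone (u, Z). mon_deg v = d} =
    (if mon_deg u \<le> d then card (mons_deg Z (d - mon_deg u)) else 0)"
  by (simp add: mon_deg_cone card_image)

text \<open>A monomial either avoids x or is x times a monomial of one degree less; on cardinalities
  this becomes Pascal's rule.\<close>

lemma mons_deg_insert_Suc: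
  assumes "x \<notin> Z"
  shows "mons_deg (insert x Z) (Suc d) = mons_deg Z (Suc d) \<union> (+) (coord x) ` mons_deg (insert x Z) d"
proof (intro equalityI subsetI)
  fix u assume u: "u \<in> mons_deg (insert x Z) (Suc d)"
  show "u \<in> mons_deg Z (Suc d) \<union> (+) (coord x) ` mons_deg (insert x Z) d"
  proof (cases "x \<in> keys u")
    case True
    have "mon_deg (coord x + (u - coord x)) = Suc d"
      using u by (simp add: coord_plus_minus[OF True] mons_deg_def del: One_nat_def)
    then have "u - coord x \<in> mons_deg (insert x Z) d"
      using u by (simp add: mons_deg_def mon_deg_add mon_deg_single mons_in_minus)
    then show ?thesis
      by (metis UnI2 coord_plus_minus[OF True] image_eqI)
  next
    case False
    then show ?thesis
      using u by (auto simp: mons_deg_def mons_in_def)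
  qed
qed (use assms in \<open>auto simp: mons_deg_def mons_in_def keys_add_mon mon_deg_add mon_deg_single\<close>)

lemma card_mons_deg_insert:
  assumes "finite Z" "x \<notin> Z"
  shows "card (mons_deg (insert x Z) (Suc d)) = card (mons_deg Z (Suc d)) + card (mons_deg (insert x Z) d)"
proof -
  have "mons_deg Z (Suc d) \<inter> (+) (coord x) ` mons_deg (insert x Z) d = {}"
    using assms(2) by (auto simp: mons_deg_def mons_in_def keys_add_mon)
  then show ?thesis
    unfolding mons_deg_insert_Suc[OF assms(2)]
    using assms(1) by (simp add: card_Un_disjoint finite_mons_deg card_image)
qed

text \<open>Stars and bars. For empty Z the truncated upper entry still gives 1 in degree 0 and 0 in
  every other degree.\<close>

lemma card_mons_deg:
  assumes "finite Z"
  shows "card (mons_deg Z d) = (d + card Z - 1) choose d"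
  using assms
proof (induction Z arbitrary: d rule: finite_induct)
  case empty
  have "mons_deg {} (Suc d) = {}" for d
    using mon_deg_zero by (auto simp: mons_deg_def mons_in_def mon_deg_def)
  then show ?case
    by (cases d) (simp_all add: mons_deg_0)
next
  case (insert x Z)
  show ?case
  proof (induction d)
    case (Suc d)
    show ?case
      using card_mons_deg_insert[OF insert.hyps] Suc insert.IH[of "Suc d"] insert.hyps by simp
  qed (simp add: mons_deg_0)
qed

text \<open>\<open>hs k\<close> is 1 / (1 - t)^k, the Hilbert series of a polynomial ring in k variables.
  For d = k = 0 the truncated d + k - 1 gives 0 choose 0 = 1, as it should.\<close>

definition hs :: "nat \<Rightarrow> int fps" where
  "hs k = Abs_fps (\<lambda>d. int ((d + k - 1) choose d))"

lemma hs_0: "hs 0 = 1"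
  by (rule fps_ext) (auto simp: hs_def)

text \<open>Pascal's rule in terms of generating functions.\<close>

lemma hs_Suc: "hs k = hs (Suc k) * (1 - fps_X)"
proof (rule fps_ext)
  fix d show "fps_nth (hs k) d = fps_nth (hs (Suc k) * (1 - fps_X)) d"
    by (cases d) (simp_all add: hs_def right_diff_distrib fps_X_mult_right_nth)
qed

lemma hs_diff: "k \<le> n \<Longrightarrow> hs k = hs n * (1 - fps_X) ^ (n - k)"
proof (induction n)
  case (Suc n)
  then show ?case
    by (cases "k = Suc n") (simp_all add: hs_Suc[of n] Suc_diff_le mult_ac)
qed simp

lemma hilbert_series_identity:
  fixes X H :: "'a::idom"
  shows "X * (H - H * (1 - X) ^ 10) + X ^ 2 * (H * (1 - X)) + X ^ 2 * (H * (1 - X) ^ 2) =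
     12 * (X ^ 2 * (H * (1 - X) ^ 4)) + 49 * (X ^ 4 * (H * (1 - X) ^ 4)) + 34 * (X ^ 5 * (H * (1 - X) ^ 4))
     + 82 * (X ^ 6 * (H * (1 - X) ^ 4)) + 110 * (X ^ 7 * (H * (1 - X) ^ 4)) + 155 * (X ^ 8 * (H * (1 - X) ^ 3))
     + 54 * (X ^ 9 * (H * (1 - X) ^ 2)) + 11 * (X ^ 10 * (H * (1 - X))) + X ^ 11 * H"
  by Groebner_Basis.algebra \<comment> \<open>qualified, since HOL-Algebra has another method of this name\<close>

text \<open>On the left is the Hilbert series of L2. After multiplication by (1 - X)^10 both sides
  are polynomials of degree 11. The products X^s (1 - X)^4 for s \<le> 7, X^8 (1 - X)^3, X^9 (1 -
  X)^2, X^10 (1 - X) and X^11 begin in the degrees 0 to 11, one each, and so form a basis of the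
  polynomials of degree at most 11. The coefficients are therefore forced: each is what the earlier
  summands leave over in its degree. None is negative, and the one for s = 3 vanishes because 72 -
  12 * 6 = 0.\<close>

lemma hs_identity:
  "fps_X * (hs 10 - 1) + fps_X ^ 2 * hs 9 + fps_X ^ 2 * hs 8 =
     12 * (fps_X ^ 2 * hs 6) + 49 * (fps_X ^ 4 * hs 6) + 34 * (fps_X ^ 5 * hs 6)
     + 82 * (fps_X ^ 6 * hs 6) + 110 * (fps_X ^ 7 * hs 6) + 155 * (fps_X ^ 8 * hs 7)
     + 54 * (fps_X ^ 9 * hs 8) + 11 * (fps_X ^ 10 * hs 9) + fps_X ^ 11 * hs 10"
  using hilbert_series_identity[of fps_X "hs 10"] hs_diff[of 9 10] hs_diff[of 8 10]
    hs_diff[of 7 10] hs_diff[of 6 10] hs_diff[of 0 10]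
  by (simp add: hs_0)

lemma cone_iff_mons:
  assumes "u \<in> mons_in V" "Z \<subseteq> V"
  shows "v \<in> cone (u, Z) \<longleftrightarrow> v \<in> mons_in V \<and>
    (\<forall>i\<in>Z. lookup u i \<le> lookup v i) \<and> (\<forall>i\<in>V - Z. lookup v i = lookup u i)"
proof -
  have "v \<in> mons_in V \<longleftrightarrow> (\<forall>i. i \<notin> V \<longrightarrow> lookup v i = 0)" for v
    by (auto simp: mons_in_def in_keys_iff)
  with assms show ?thesis
    unfolding cone_iff by (metis DiffD1 DiffD2 DiffI subsetD)
qed

section \<open>The ideal L2\<close>

text \<open>The ten generators divisible by x_1 are x_1 times every variable, so a monomial is a
  multiple of one of them iff x_1 divides it properly; hence the condition on the degree.\<close>

definition L2_mons :: "mon set" where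
  "L2_mons = {v \<in> mons_in {1..10}. lookup v 1 \<ge> 1 \<and> mon_deg v \<ge> 2 \<or>
     lookup v 2 \<ge> 2 \<or> lookup v 2 \<ge> 1 \<and> lookup v 3 \<ge> 1}"

definition L2_gens :: "mon set" where
  "L2_gens = (\<lambda>j. coord 1 + coord j) ` {1..10} \<union> {coord 2 + coord 2, coord 2 + coord 3}"

lemma L2_gens_subset: "L2_gens \<subseteq> mons_in {1..10}"
  by (auto simp: L2_gens_def mons_in_add coord_in_mons_in simp del: One_nat_def)

lemma mon_deg_L2_mons: "v \<in> L2_mons \<Longrightarrow> 2 \<le> mon_deg v"
  using lookup_add_lookup_le_mon_deg[of 2 3 v] by (auto simp: L2_mons_def)

lemma L2_gens_upset: "{g + u | g u. g \<in> L2_gens \<and> u \<in> mons_in {1..10}} = L2_mons"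
proof (intro equalityI subsetI)
  fix v assume "v \<in> {g + u | g u. g \<in> L2_gens \<and> u \<in> mons_in {1..10}}"
  then obtain g u where v: "v = g + u" and g: "g \<in> L2_gens" and u: "u \<in> mons_in {1..10}" by blast
  then have "v \<in> mons_in {1..10}" using L2_gens_subset by (auto simp: mons_in_add)
  with g show "v \<in> L2_mons"
    by (auto simp: L2_mons_def L2_gens_def v lookup_add lookup_single mon_deg_add mon_deg_single)
next
  fix v assume v: "v \<in> L2_mons"
  have upset: "v \<in> {g + u | g u. g \<in> L2_gens \<and> u \<in> mons_in {1..10}}"
    if "g \<in> L2_gens" "\<And>i. lookup g i \<le> lookup v i" for g
    using mon_minus_add[OF that(2)] that(1) v mons_in_minus[of v "{1..10}" g]
    by (auto simp: L2_mons_def)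
  have "\<exists>g\<in>L2_gens. \<forall>i. lookup g i \<le> lookup v i"
    if "lookup v 1 \<ge> 1" "mon_deg v \<ge> 2"
  proof -
    \<comment> \<open>After removal of one x_1 the cofactor has positive degree, so it contains some
      x_j, possibly x_1 again.\<close>
    have v1: "coord 1 + (v - coord 1) = v"
      using that(1) by (intro coord_plus_minus) (simp add: in_keys_iff)
    have "mon_deg (v - coord 1) \<noteq> 0"
      using arg_cong[OF v1, of mon_deg] that(2) by (simp add: mon_deg_add mon_deg_single)
    then obtain j where j: "j \<in> keys (v - coord 1)"
      by (metis all_not_in_conv mon_deg_zero poly_mapping_sum_single sum.empty)
    have "coord 1 + (coord j + (v - coord 1 - coord j)) = v"
      by (simp only: coord_plus_minus[OF j] v1)
    then have "\<forall>i. lookup (coord 1 + coord j) i \<le> lookup v i"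
      by (metis add.assoc le_add1 lookup_add)
    moreover have "j \<in> {1..10}"
      using j v mons_in_minus[of v "{1..10}" "coord 1"] by (auto simp: L2_mons_def mons_in_def)
    ultimately show ?thesis unfolding L2_gens_def by blast
  qed
  moreover have "lookup (coord 2 + coord 2) i \<le> lookup v i" if "lookup v 2 \<ge> 2" for i
    using that by (auto simp: lookup_add lookup_single when_def)
  moreover have "lookup (coord 2 + coord 3) i \<le> lookup v i" if "lookup v 2 \<ge> 1" "lookup v 3 \<ge> 1" for i
    using that by (auto simp: lookup_add lookup_single when_def)
  moreover have "coord 2 + coord 2 \<in> L2_gens" "coord 2 + coord 3 \<in> L2_gens"
    by (simp_all add: L2_gens_def)
  ultimately show "v \<in> {g + u | g u. g \<in> L2_gens \<and> u \<in> mons_in {1..10}}"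
    using v upset unfolding L2_mons_def by blast
qed

lemma L2_eq:
  "Idl\<^bsub>poly_ring 10\<^esub>
     ({var 1 ^ 2} \<union> {var 1 * var j | j. j \<in> {2..10}} \<union> {var 2 ^ 2, var 2 * var 3})
   = (supported L2_mons :: 'k::field mpoly set)"
  and monomial_ideal_L2: "monomial_ideal 10 (supported L2_mons :: 'k::field mpoly set)"
proof -
  have "var i * var j = (monom_poly (coord i + coord j) :: 'k mpoly)" for i j
    by (simp add: var_def monom_poly_def mult_single)
  moreover have "{1..10::nat} = insert 1 {2..10}" by auto
  ultimately have "{var 1 ^ 2} \<union> {var 1 * var j | j. j \<in> {2..10}} \<union> {var 2 ^ 2, var 2 * var 3}
      = (monom_poly ` L2_gens :: 'k mpoly set)"
    unfolding L2_gens_def power2_eq_square by (auto simp del: One_nat_def)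
  moreover have *: "Idl\<^bsub>poly_ring 10\<^esub> (monom_poly ` L2_gens) = (supported L2_mons :: 'k mpoly set)"
    using Idl_monom_poly[OF L2_gens_subset] by (simp only: L2_gens_upset)
  ultimately show "Idl\<^bsub>poly_ring 10\<^esub>
     ({var 1 ^ 2} \<union> {var 1 * var j | j. j \<in> {2..10}} \<union> {var 2 ^ 2, var 2 * var 3})
   = (supported L2_mons :: 'k mpoly set)" by (simp only:)
  show "monomial_ideal 10 (supported L2_mons :: 'k mpoly set)"
    unfolding monomial_ideal_def using L2_gens_subset * by blast
qed

lemma lex_ideal_L2: "lex_ideal 10 (supported L2_mons :: 'k::field mpoly set)"
proof -
  have "v \<in> L2_mons"
    if "v \<in> mons_in {1..10}" "u \<in> mons_in {1..10}" "u \<in> L2_mons" "mon_deg v = mon_deg u" "u < v" for u v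
  proof -
    from \<open>u < v\<close> obtain k where k: "lookup u k < lookup v k" "\<And>i. i < k \<Longrightarrow> lookup u i = lookup v i"
      unfolding less_poly_mapping.rep_eq by (auto elim: less_funE)
    \<comment> \<open>Exponent vectors are indexed from 0 and variables from 1, so index 0 has to be
      excluded as the place of the first difference.\<close>
    moreover have "lookup v 0 = 0"
      using that(1) by (force simp: mons_in_def simp flip: not_in_keys_iff_lookup_eq_zero)
    ultimately have "k \<noteq> 0" by (metis not_less_zero)
    \<comment> \<open>Membership in L2 depends on the degree and the first three exponents only. A
      first difference among these three raises an exponent of v and leaves the earlier ones equal;
      a later one leaves all three unchanged.\<close>
    then consider "k = 1" | "k = 2" | "k = 3" | "k > 3" by linarith
    then show ?thesis
      using that mon_deg_L2_mons[of u] k(1) k(2)[of 1] k(2)[of 2] k(2)[of 3] by cases (auto simp: L2_mons_def)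
  qed
  then show ?thesis
    unfolding lex_ideal_def monom_poly_in_supported using monomial_ideal_L2 by blast
qed

lemma cone_1: "v \<in> cone (coord 1, {1..10}) \<longleftrightarrow> v \<in> mons_in {1..10} \<and> 1 \<le> lookup v 1"
  by (subst cone_iff_mons[of _ "{1..10}"]) (auto simp: coord_in_mons_in lookup_single when_def)

lemma cone_11: "v \<in> cone (coord 1 + coord 1, {1..10}) \<longleftrightarrow> v \<in> mons_in {1..10} \<and> 2 \<le> lookup v 1"
  by (subst cone_iff_mons[of _ "{1..10}"])
    (auto simp: mons_in_add coord_in_mons_in lookup_add lookup_single when_def)

lemma cone_22:
  "v \<in> cone (coord 2 + coord 2, {2..10}) \<longleftrightarrow>
     v \<in> mons_in {1..10} \<and> lookup v 1 = 0 \<and> 2 \<le> lookup v 2"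
proof -
  have rest: "{1..10} - {2..10} = {1::nat}" by auto
  have "coord 2 + coord 2 \<in> mons_in {1..10}" "{2..10} \<subseteq> {1..10::nat}"
    by (simp_all add: mons_in_add coord_in_mons_in)
  from cone_iff_mons[OF this] show ?thesis
    unfolding rest by (simp add: lookup_add lookup_single when_def) (auto simp: all_conj_distrib)
qed

lemma cone_23:
  "v \<in> cone (coord 2 + coord 3, {3..10}) \<longleftrightarrow>
     v \<in> mons_in {1..10} \<and> lookup v 1 = 0 \<and> lookup v 2 = 1 \<and> 1 \<le> lookup v 3"
proof -
  have rest: "{1..10} - {3..10} = {1, 2::nat}" by auto
  have "coord 2 + coord 3 \<in> mons_in {1..10}" "{3..10} \<subseteq> {1..10::nat}"
    by (simp_all add: mons_in_add coord_in_mons_in)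
  from cone_iff_mons[OF this] show ?thesis
    unfolding rest by (simp add: lookup_add lookup_single when_def) (auto simp: all_conj_distrib)
qed

text \<open>Sorted by divisibility by x_1 and then by the exponent of x_2, the ideal falls into
  three disjoint pieces, whose sizes can be counted. Only x_1 itself has to be removed, being the
  one multiple of x_1 of degree below 2; this is the -1 in the Hilbert series.\<close>

lemma L2_mons_eq:
  "L2_mons = (cone (coord 1, {1..10}) - {coord 1}) \<union> cone (coord 2 + coord 2, {2..10})
     \<union> cone (coord 2 + coord 3, {3..10})"
proof -
  have "2 \<le> mon_deg v \<longleftrightarrow> v \<noteq> coord 1" if "1 \<le> lookup v 1" for v
  proof -
    have v: "coord 1 + (v - coord 1) = v"
      using that by (intro coord_plus_minus) (simp add: in_keys_iff)
    have "mon_deg v = 1 + mon_deg (v - coord 1)"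
      using arg_cong[OF v, of mon_deg] by (simp add: mon_deg_add mon_deg_single)
    moreover have "v = coord 1 \<longleftrightarrow> v - coord 1 = 0"
    proof
      assume "v - coord 1 = 0"
      from v[unfolded this] show "v = coord 1" by simp
    qed simp
    ultimately show ?thesis
      using mon_deg_eq_0_iff[of "v - coord 1"] by auto
  qed
  moreover have "2 \<le> mon_deg v" if "v \<in> mons_in {1..10}"
    "2 \<le> lookup v 2 \<or> 1 \<le> lookup v 2 \<and> 1 \<le> lookup v 3" for v
    using that by (intro mon_deg_L2_mons) (auto simp: L2_mons_def)
  ultimately have "v \<in> L2_mons \<longleftrightarrow> v \<in> (cone (coord 1, {1..10}) - {coord 1})
      \<union> cone (coord 2 + coord 2, {2..10}) \<union> cone (coord 2 + coord 3, {3..10})" for v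
    unfolding Un_iff Diff_iff singleton_iff cone_1 cone_22 cone_23 L2_mons_def mem_Collect_eq
    by (cases "lookup v 1 = 0") (auto simp: Suc_le_eq)
  then show ?thesis by blast
qed

lemma card_L2_mons_deg:
  "card {v \<in> L2_mons. mon_deg v = d} =
     (if 2 \<le> d then ((d + 8) choose (d - 1)) + ((d + 6) choose (d - 2)) + ((d + 5) choose (d - 2)) else 0)"
proof -
  let ?C = "\<lambda>u Z. {v \<in> cone (u, Z). mon_deg v = d}"
  have fin: "finite (?C u {a..b})" for u a b
    by (simp add: mon_deg_cone finite_mons_deg)
  have "{v \<in> L2_mons. mon_deg v = d} = (?C (coord 1) {1..10} - {coord 1})
      \<union> ?C (coord 2 + coord 2) {2..10} \<union> ?C (coord 2 + coord 3) {3..10}"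
    unfolding L2_mons_eq by blast
  moreover have disj: "?C (coord 2 + coord 2) {2..10} \<inter> ?C (coord 2 + coord 3) {3..10} = {}"
    "?C (coord 1) {1..10} \<inter> (?C (coord 2 + coord 2) {2..10} \<union> ?C (coord 2 + coord 3) {3..10}) = {}"
    unfolding cone_1 cone_22 cone_23 by auto
  have "card (?C (coord 2 + coord 2) {2..10} \<union> ?C (coord 2 + coord 3) {3..10})
      = card (?C (coord 2 + coord 2) {2..10}) + card (?C (coord 2 + coord 3) {3..10})"
    using disj(1) by (intro card_Un_disjoint fin)
  moreover have "card ((?C (coord 1) {1..10} - {coord 1}) \<union>
        (?C (coord 2 + coord 2) {2..10} \<union> ?C (coord 2 + coord 3) {3..10}))
      = card (?C (coord 1) {1..10} - {coord 1}) +
        card (?C (coord 2 + coord 2) {2..10} \<union> ?C (coord 2 + coord 3) {3..10})"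
    using disj(2) by (intro card_Un_disjoint finite_UnI finite_Diff fin) blast
  ultimately have "card {v \<in> L2_mons. mon_deg v = d} = card (?C (coord 1) {1..10} - {coord 1})
      + card (?C (coord 2 + coord 2) {2..10}) + card (?C (coord 2 + coord 3) {3..10})"
    by (simp only: Un_assoc add.assoc)
  moreover have "card (?C (coord 1) {1..10} - {coord 1}) =
      (if 2 \<le> d then (d + 8) choose (d - 1) else 0)"
  proof (cases "2 \<le> d")
    case True
    then have "coord 1 \<notin> ?C (coord 1) {1..10}"
      by (simp add: mon_deg_single)
    with True show ?thesis
      by (simp add: card_cone_deg mon_deg_single card_mons_deg add.commute)
  next
    case False
    then have "d = 0 \<or> d = 1" by auto
    then show ?thesis
      by (auto simp: mon_deg_cone mon_deg_single mons_deg_0)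
  qed
  ultimately show ?thesis
    by (simp add: card_cone_deg mon_deg_add mon_deg_single card_mons_deg add.commute
        flip: numeral_2_eq_2)
qed

lemma finite_L2_mons_deg: "finite {v \<in> L2_mons. mon_deg v = d}"
  by (rule finite_subset[OF _ finite_mons_deg[of "{1..10}" d]])
    (auto simp: L2_mons_def mons_deg_def)

lemma card_L2_mons_deg_hs:
  "int (card {v \<in> L2_mons. mon_deg v = d}) =
     fps_nth (fps_X * (hs 10 - 1) + fps_X ^ 2 * hs 9 + fps_X ^ 2 * hs 8) d"
  by (auto simp: card_L2_mons_deg fps_X_power_mult_nth hs_def add.commute)

section \<open>Depth as a maximum over decompositions\<close>

lemma decomp_depth_le: "p \<in> set D \<Longrightarrow> decomp_depth D \<le> card (snd p)"
  unfolding decomp_depth_def by (rule Min_le) (auto simp: case_prod_unfold)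

lemma le_decomp_depth:
  "D \<noteq> [] \<Longrightarrow> (\<And>p. p \<in> set D \<Longrightarrow> k \<le> card (snd p)) \<Longrightarrow> k \<le> decomp_depth D"
  unfolding decomp_depth_def by (subst Min_ge_iff) (auto simp: case_prod_unfold)

text \<open>\<open>Max\<close> needs a finite set, and the upper bound supplies finiteness. Phrasing
  that bound as the existence of a small summand also excludes the empty list, whose depth would be
  the minimum of the empty set.\<close>

lemma Max_decomp_depth_eqI:
  assumes upper: "\<And>D. P D \<Longrightarrow> \<exists>p\<in>set D. card (snd p) \<le> k"
    and D: "P D" "\<And>p. p \<in> set D \<Longrightarrow> k \<le> card (snd p)"
  shows "Max {decomp_depth D | D. P D} = k"
proof (rule Max_eqI)
  have le: "decomp_depth D \<le> k" if "P D" for D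
    using upper[OF that] decomp_depth_le le_trans by blast
  then show "finite {decomp_depth D | D. P D}"
    by (auto intro!: finite_subset[OF _ finite_atMost[of k]])
  show "y \<le> k" if "y \<in> {decomp_depth D | D. P D}" for y
    using that le by blast
  have "D \<noteq> []" using upper[OF D(1)] by auto
  then have "decomp_depth D = k"
    using le[OF D(1)] le_decomp_depth[OF _ D(2)] by (simp add: antisym)
  then show "k \<in> {decomp_depth D | D. P D}" using D(1) by blast
qed

section \<open>Stanley depth of L2\<close>

lemma card_L2_mons_2: "card {v \<in> L2_mons. mon_deg v = 2} = 12"
  and card_L2_mons_3: "card {v \<in> L2_mons. mon_deg v = 3} = 72"
  by (simp_all add: card_L2_mons_deg choose_two)

lemma stanley_decomp_L2_small_piece:
  assumes D: "stanley_decomp 10 (supported L2_mons :: 'k::field mpoly set) D"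
  shows "\<exists>p\<in>set D. card (snd p) \<le> 5"
proof (rule ccontr)
  assume "\<not> ?thesis"
  then have large: "6 \<le> card (snd p)" if "p \<in> set D" for p
    using that by force
  have "L2_mons \<subseteq> mons_in {1..10}" by (auto simp: L2_mons_def)
  note * = D[unfolded stanley_decomp_supported_iff[OF this]]
  have cone_sub: "cone (u, Z) \<subseteq> L2_mons" and Z: "finite Z" if "(u, Z) \<in> set D" for u Z
    using * that finite_subset[of Z "{1..10}"] by force+
  have ex: "\<exists>p\<in>set D. v \<in> cone p" if "v \<in> L2_mons" for v
    using * that nth_mem by metis
  have unique: "p = q" if "p \<in> set D" "q \<in> set D" "v \<in> cone p" "v \<in> cone q" for p q v
  proof -
    have "v \<in> L2_mons" using that * by blast
    then show ?thesis using * that by (metis in_set_conv_nth)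
  qed
  \<comment> \<open>All generators except x_2^2.\<close>
  define G where "G = (\<lambda>j. coord 1 + coord j) ` {1..10} \<union> {coord 2 + coord 3}"
  have G: "G \<subseteq> L2_mons" "\<And>g. g \<in> G \<Longrightarrow> mon_deg g = 2"
    by (auto simp: G_def L2_mons_def mons_in_add coord_in_mons_in lookup_add lookup_single
        mon_deg_add mon_deg_single)
  have "inj_on (\<lambda>j. coord 1 + coord j) {1..10}"
    by (rule inj_onI) (metis add_left_cancel keys_single singleton_inject nat.distinct(1))
  moreover have "coord 2 + coord 3 \<notin> (\<lambda>j. coord 1 + coord j) ` {1..10}"
  proof
    assume "coord 2 + coord 3 \<in> (\<lambda>j. coord 1 + coord j) ` {1..10}"
    then obtain j where "coord 2 + coord 3 = coord 1 + coord j" by blast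
    then have "lookup (coord 2 + coord 3) 1 = lookup (coord 1 + coord j) 1" by simp
    then show False by (simp add: lookup_add lookup_single)
  qed
  ultimately have card_G: "card G = 11"
    by (simp add: G_def card_image)
  \<comment> \<open>L2 has nothing below degree 2, so a cone inside L2 that contains a generator can
    only start at it.\<close>
  have head: "\<exists>Z. (g, Z) \<in> set D" if g: "g \<in> G" for g
  proof -
    obtain u Z where p: "(u, Z) \<in> set D" "g \<in> cone (u, Z)"
      using ex[of g] g G(1) by force
    then obtain w where w: "g = u + w" by (auto simp: cone_def)
    have "u \<in> L2_mons" using cone_sub[OF p(1)] by (auto simp: cone_iff)
    then have "mon_deg w = 0"
      using mon_deg_L2_mons[of u] G(2)[OF g] by (simp add: w mon_deg_add)
    then have "g = u" by (simp add: w mon_deg_eq_0_iff)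
    with p show ?thesis by blast
  qed
  then obtain Z where Z_D: "\<And>g. g \<in> G \<Longrightarrow> (g, Z g) \<in> set D" by metis
  define E where "E g = (\<lambda>j. g + coord j) ` Z g" for g
  \<comment> \<open>The factors x_1 and x_3 are left out, since x_1 x_2^2 and x_2^2 x_3 are
    multiples of members of G.\<close>
  define X where "X = (\<lambda>j. coord 2 + coord 2 + coord j) ` ({2..10} - {3})"
  have inj: "inj_on (\<lambda>j. g + coord j) A" for g A
    by (rule inj_onI) (metis add_left_cancel keys_single singleton_inject nat.distinct(1))
  have E_cone: "E g \<subseteq> cone (g, Z g)" for g
    by (auto simp: E_def cone_def coord_in_mons_in)
  have card_E: "6 \<le> card (E g)" and fin_E: "finite (E g)" if "g \<in> G" for g
    using large[OF Z_D[OF that]] Z[OF Z_D[OF that]] by (simp_all add: E_def card_image inj)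
  have disj_E: "E g \<inter> E h = {}" if "g \<in> G" "h \<in> G" "g \<noteq> h" for g h
  proof (rule ccontr)
    assume "E g \<inter> E h \<noteq> {}"
    then obtain v where "v \<in> cone (g, Z g)" "v \<in> cone (h, Z h)" using E_cone by blast
    with unique[OF Z_D Z_D] that show False by blast
  qed
  have "(\<Union>g\<in>G. E g) \<inter> X = {}"
  proof (rule ccontr)
    assume "(\<Union>g\<in>G. E g) \<inter> X \<noteq> {}"
    then obtain g i j where g: "g \<in> G" and eq: "g + coord i = coord 2 + coord 2 + coord j"
      and j: "j \<in> {2..10} - {3}"
      unfolding E_def X_def by blast
    \<comment> \<open>Every member of G involves x_1 or x_3, and no element of X does.\<close>
    have "lookup (coord 2 + coord 2 + coord j) 1 = 0" "lookup (coord 2 + coord 2 + coord j) 3 = 0"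
      using j by (auto simp: lookup_add lookup_single when_def)
    then have "lookup g 1 = 0" "lookup g 3 = 0"
      unfolding eq[symmetric] by (auto simp: lookup_add)
    with g show False
      by (auto simp: G_def lookup_add lookup_single)
  qed
  then have "card ((\<Union>g\<in>G. E g) \<union> X) = card (\<Union>g\<in>G. E g) + card X"
    using fin_E by (intro card_Un_disjoint) (auto simp: X_def G_def)
  moreover have "card (\<Union>g\<in>G. E g) = (\<Sum>g\<in>G. card (E g))"
    using fin_E disj_E by (intro card_UN_disjoint) (auto simp: G_def)
  moreover have "(\<Sum>g\<in>G. 6) \<le> (\<Sum>g\<in>G. card (E g))"
    by (rule sum_mono) (rule card_E)
  moreover have "card X = 8"
    unfolding X_def by (simp add: card_image inj)
  moreover have "(\<Union>g\<in>G. E g) \<union> X \<subseteq> {v \<in> L2_mons. mon_deg v = 3}"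
  proof -
    have "E g \<subseteq> {v \<in> L2_mons. mon_deg v = 3}" if "g \<in> G" for g
      using E_cone[of g] cone_sub[OF Z_D[OF that]] G(2)[OF that]
      by (auto simp: E_def mon_deg_add mon_deg_single)
    moreover have "X \<subseteq> {v \<in> L2_mons. mon_deg v = 3}"
      by (auto simp: X_def L2_mons_def mons_in_add coord_in_mons_in lookup_add lookup_single
        mon_deg_add mon_deg_single)
    ultimately show ?thesis by blast
  qed
  then have "card ((\<Union>g\<in>G. E g) \<union> X) \<le> card {v \<in> L2_mons. mon_deg v = 3}"
    by (rule card_mono[OF finite_L2_mons_deg])
  moreover have "card {v \<in> L2_mons. mon_deg v = 3} = 72"
    by (rule card_L2_mons_3)
  \<comment> \<open>11 * 6 + 8 = 74 exceeds 72.\<close>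
  ultimately show False
    by (simp add: card_G)
qed

definition squarefree_mon :: "nat set \<Rightarrow> mon" where
  "squarefree_mon A = (\<Sum>a\<in>A. coord a)"

lemma lookup_squarefree_mon: "finite A \<Longrightarrow> lookup (squarefree_mon A) i = (if i \<in> A then 1 else 0)"
  by (simp add: squarefree_mon_def lookup_sum lookup_single when_def)

text \<open>In x_1 x^A K[B] the exponents are positive on A, free on the rest of B and 0 outside B,
  except that x_1, which is not in B, keeps exponent 1. So only the support matters, and disjoint
  intervals give disjoint cones.\<close>

lemma cone_squarefree:
  assumes "A \<subseteq> B" "B \<subseteq> {2..10}"
  shows "v \<in> cone (coord 1 + squarefree_mon A, B) \<longleftrightarrow>
    v \<in> mons_in {1..10} \<and> lookup v 1 = 1 \<and> keys v - {1} \<in> {A..B}"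
proof -
  have fin: "finite A"
    by (rule finite_subset[OF subset_trans[OF assms]]) simp
  define w where "w = coord 1 + squarefree_mon A"
  have w: "lookup w i = (if i = 1 \<or> i \<in> A then 1 else 0)" for i
    using assms by (auto simp: w_def lookup_add lookup_single when_def lookup_squarefree_mon[OF fin])
  have "keys w \<subseteq> insert 1 A"
    by (auto simp: in_keys_iff w split: if_splits)
  then have "w \<in> mons_in {1..10}"
    using assms by (force simp: mons_in_def)
  moreover have "B \<subseteq> {1..10}" using assms(2) by auto
  ultimately have cone: "v \<in> cone (w, B) \<longleftrightarrow> v \<in> mons_in {1..10} \<and>
      (\<forall>i\<in>B. (if i = 1 \<or> i \<in> A then 1 else 0) \<le> lookup v i) \<and>
      (\<forall>i\<in>{1..10} - B. lookup v i = (if i = 1 \<or> i \<in> A then 1 else 0))"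
    unfolding w[symmetric] by (rule cone_iff_mons)
  have lower: "(\<forall>i\<in>B. (if i = 1 \<or> i \<in> A then 1 else 0) \<le> lookup v i) \<longleftrightarrow> A \<subseteq> keys v"
    using assms by (force simp: in_keys_iff)
  have upper: "(\<forall>i\<in>{1..10} - B. lookup v i = (if i = 1 \<or> i \<in> A then 1 else 0)) \<longleftrightarrow>
      lookup v 1 = 1 \<and> keys v - {1} \<subseteq> B" if "keys v \<subseteq> {1..10}"
  proof -
    define R where "R = {1..10} - B - {1}"
    then have "1 \<notin> R" by blast
    have "1 \<notin> B" using assms(2) by auto
    have "(\<forall>i\<in>{1..10} - B. lookup v i = (if i = 1 \<or> i \<in> A then 1 else 0)) \<longleftrightarrow>
        (\<forall>i\<in>insert 1 R. lookup v i = (if i = 1 then 1 else 0))"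
      using assms \<open>1 \<notin> B\<close> by (intro ball_cong) (auto simp: R_def)
    also have "(\<forall>i\<in>insert 1 R. lookup v i = (if i = 1 then 1 else 0)) \<longleftrightarrow>
        lookup v 1 = 1 \<and> (\<forall>i\<in>R. lookup v i = 0)"
      using \<open>1 \<notin> R\<close> by (metis insert_iff)
    also have "(\<forall>i\<in>R. lookup v i = 0) \<longleftrightarrow> keys v - {1} \<subseteq> B"
      unfolding R_def not_in_keys_iff_lookup_eq_zero[symmetric] using that by blast
    finally show ?thesis .
  qed
  have A: "A \<subseteq> keys v \<longleftrightarrow> A \<subseteq> keys v - {1}" using assms by force
  show ?thesis
  proof (cases "keys v \<subseteq> {1..10}")
    case True
    show ?thesis
      unfolding w_def[symmetric] cone lower upper[OF True] atLeastAtMost_iff using A by argo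
  next
    case False
    then show ?thesis
      unfolding w_def[symmetric] cone mons_in_def mem_Collect_eq by argo
  qed
qed

lemma stanley_decomp_L2:
  obtains D where "stanley_decomp 10 (supported L2_mons :: 'k::field mpoly set) D"
    "\<And>p. p \<in> set D \<Longrightarrow> 5 \<le> card (snd p)"
proof -
  let ?F = "Pow {2..10::nat} - {{}}"
  obtain Q where Q: "finite Q" "\<forall>p\<in>Q. fst p \<subseteq> snd p \<and> 5 \<le> card (snd p)"
    "\<forall>S\<in>?F. \<exists>!p. p \<in> Q \<and> S \<in> {fst p..snd p}" "\<forall>p\<in>Q. {fst p..snd p} \<subseteq> ?F"
    using interval_partitionable_2_to_10 unfolding interval_partitionable_def by blast
  have Q_sub: "fst q \<subseteq> snd q" "snd q \<subseteq> {2..10}" if "q \<in> Q" for q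
  proof -
    show "fst q \<subseteq> snd q" using Q(2) that by blast
    then have "snd q \<in> ?F"
      by (intro subsetD[OF bspec[OF Q(4) that]]) simp
    then show "snd q \<subseteq> {2..10}" by blast
  qed
  define c where "c q = (coord 1 + squarefree_mon (fst q), snd q)" for q :: "nat set \<times> nat set"
  have cone_c: "v \<in> cone (c q) \<longleftrightarrow>
      v \<in> mons_in {1..10} \<and> lookup v 1 = 1 \<and> keys v - {1} \<in> {fst q..snd q}" if "q \<in> Q" for q v
    unfolding c_def using cone_squarefree[OF Q_sub[OF that]] .
  \<comment> \<open>Three cones with 10, 9 and 8 variables take the monomials whose exponent of x_1
    is not 1; the cones \<open>c q\<close> take the others.\<close>
  let ?p1 = "(coord 1 + coord 1, {1..10})" and ?p2 = "(coord 2 + coord 2, {2..10})"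
    and ?p3 = "(coord 2 + coord 3, {3..10})"
  let ?P = "insert ?p1 (insert ?p2 (insert ?p3 (c ` Q)))"
  have sub: "cone p \<subseteq> L2_mons" if p: "p \<in> ?P" for p
  proof
    fix v assume v: "v \<in> cone p"
    consider "v \<in> cone ?p1" | "v \<in> cone ?p2" | "v \<in> cone ?p3" | q where "q \<in> Q" "v \<in> cone (c q)"
      using v p by blast
    then show "v \<in> L2_mons"
    proof cases
      case 1
      then show ?thesis
        using lookup_add_lookup_le_mon_deg[of 1 2 v] unfolding cone_11 L2_mons_def by auto
    next
      case 2
      then show ?thesis unfolding cone_22 L2_mons_def by auto
    next
      case 3
      then show ?thesis unfolding cone_23 L2_mons_def by auto
    next
      case 4
      then have v: "v \<in> mons_in {1..10}" "lookup v 1 = 1" "keys v - {1} \<in> ?F"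
        using Q(4) cone_c[OF 4(1), of v] by blast+
      then obtain i where "i \<in> keys v" "i \<noteq> 1" by blast
      then have "1 \<le> lookup v i" by (simp add: in_keys_iff Suc_le_eq)
      then show ?thesis
        using v(1,2) lookup_add_lookup_le_mon_deg[of 1 i v] \<open>i \<noteq> 1\<close> by (auto simp: L2_mons_def)
    qed
  qed
  have ex1: "\<exists>!p. p \<in> ?P \<and> v \<in> cone p" if v: "v \<in> L2_mons" for v
  proof -
    have mons: "v \<in> mons_in {1..10}" using v by (simp add: L2_mons_def)
    consider "2 \<le> lookup v 1" | "lookup v 1 = 1" | "lookup v 1 = 0" "2 \<le> lookup v 2"
      | "lookup v 1 = 0" "lookup v 2 = 1" "1 \<le> lookup v 3"
      using v by (force simp: L2_mons_def)
    then show ?thesis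
    proof cases
      case 1
      then have "v \<in> cone ?p1" "v \<notin> cone ?p2" "v \<notin> cone ?p3" "\<And>q. q \<in> Q \<Longrightarrow> v \<notin> cone (c q)"
        using mons unfolding cone_11 cone_22 cone_23 by (auto simp: cone_c)
      then show ?thesis by blast
    next
      case 2
      \<comment> \<open>Being of degree at least 2, v involves a variable besides x_1, so its
        support without x_1 is one of the nonempty sets that are partitioned.\<close>
      have "keys v \<noteq> {1}"
      proof
        assume "keys v = {1}"
        then have "mon_deg v = 1" using 2 by (simp add: mon_deg_def)
        with mon_deg_L2_mons[OF v] show False by simp
      qed
      moreover have "1 \<in> keys v" using 2 by (simp add: in_keys_iff)
      moreover have "keys v \<subseteq> {1..10}" "{1..10} - {1} = {2..10::nat}"
        using mons by (auto simp: mons_in_def)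
      ultimately have "keys v - {1} \<in> ?F" by blast
      from bspec[OF Q(3) this] obtain q where q: "q \<in> Q" "keys v - {1} \<in> {fst q..snd q}"
        "\<And>r. r \<in> Q \<Longrightarrow> keys v - {1} \<in> {fst r..snd r} \<Longrightarrow> r = q"
        by (elim ex1E) blast
      have "v \<in> cone (c q)"
        using cone_c[OF q(1)] q(2) 2 mons by blast
      moreover have "r = q" if "r \<in> Q" "v \<in> cone (c r)" for r
        using cone_c[OF that(1)] that q(3) by blast
      moreover have "v \<notin> cone ?p1" "v \<notin> cone ?p2" "v \<notin> cone ?p3"
        using 2 unfolding cone_11 cone_22 cone_23 by auto
      ultimately show ?thesis
        using q(1) by blast
    next
      case 3
      then have "v \<notin> cone ?p1" "v \<in> cone ?p2" "v \<notin> cone ?p3" "\<And>q. q \<in> Q \<Longrightarrow> v \<notin> cone (c q)"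
        using mons unfolding cone_11 cone_22 cone_23 by (auto simp: cone_c)
      then show ?thesis by blast
    next
      case 4
      then have "v \<notin> cone ?p1" "v \<notin> cone ?p2" "v \<in> cone ?p3" "\<And>q. q \<in> Q \<Longrightarrow> v \<notin> cone (c q)"
        using mons unfolding cone_11 cone_22 cone_23 by (auto simp: cone_c)
      then show ?thesis by blast
    qed
  qed
  have snd_P: "snd p \<subseteq> {1..10} \<and> 5 \<le> card (snd p)" if "p \<in> ?P" for p
    using that
  proof (elim insertE imageE)
    fix q assume "p = c q" "q \<in> Q"
    then show ?thesis using Q(2) Q_sub[of q] by (force simp: c_def)
  qed auto
  have mons: "L2_mons \<subseteq> mons_in {1..10}" and fin: "finite ?P"
    using Q(1) by (auto simp: L2_mons_def)
  have "snd p \<subseteq> {1..10} \<and> cone p \<subseteq> L2_mons" if "p \<in> ?P" for p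
    using sub[OF that] snd_P[OF that] by (rule conjI[OF conjunct1, rotated])
  from stanley_decomp_of_partition[OF mons fin this ex1, where 'k = 'k]
  obtain D where D: "set D = ?P" "stanley_decomp 10 (supported L2_mons :: 'k mpoly set) D" .
  show thesis
  proof (rule that[OF D(2)])
    fix p assume "p \<in> set D"
    with snd_P[of p] D(1) show "5 \<le> card (snd p)" by simp
  qed
qed

section \<open>Hilbert depth of L2\<close>

lemma hilbert_decomp_L2_small_piece:
  assumes D: "hilbert_decomp 10 (supported L2_mons :: 'k::field mpoly set) D"
  shows "\<exists>p\<in>set D. card (snd p) \<le> 6"
proof (rule ccontr)
  assume "\<not> ?thesis"
  then have large: "7 \<le> card (snd p)" if "p \<in> set D" for p
    using that by force
  have fin: "finite (snd p)" if "p \<in> set D" for p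
    using D that finite_subset[of "snd p" "{1..10}"] by (force simp: hilbert_decomp_def)
  define t where "t d p = (if fst p \<le> d then card (mons_deg (snd p) (d - fst p)) else 0)"
    for d and p :: "nat \<times> nat set"
  obtain \<phi> where "graded_iso (supported L2_mons :: 'k mpoly set) D \<phi>"
    using D by (auto simp: hilbert_decomp_def)
  then have sum: "(\<Sum>p\<leftarrow>D. t d p) = card {v \<in> L2_mons. mon_deg v = d}" for d
    using card_hilbert_basis_of_graded_iso[OF _ finite_L2_mons_deg fin] card_hilbert_basis[OF fin]
    by (simp add: t_def case_prod_unfold)
  \<comment> \<open>A summand shifted by s has dimension 1 in degree s, where L2 is zero if s <
    2.\<close>
  have s: "2 \<le> fst p" if "p \<in> set D" for p
  proof (rule ccontr)
    assume "\<not> 2 \<le> fst p"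
    then have "(\<Sum>q\<leftarrow>D. t (fst p) q) = 0"
      by (simp add: sum card_L2_mons_deg)
    then have "t (fst p) p = 0" using that by simp
    then show False by (simp add: t_def mons_deg_0)
  qed
  \<comment> \<open>A summand with shift 2 contributes 1 in degree 2 and its number of variables in
    degree 3; one with a larger shift contributes nothing in degree 2. Summation then gives 84 \<le>
    72.\<close>
  have "7 * t 2 p \<le> t 3 p" if "p \<in> set D" for p
    using s[OF that] large[OF that] fin[OF that]
    by (cases "fst p = 2") (auto simp: t_def card_mons_deg)
  then have "(\<Sum>p\<leftarrow>D. 7 * t 2 p) \<le> (\<Sum>p\<leftarrow>D. t 3 p)"
    by (rule sum_list_mono)
  then show False
    by (simp add: sum_list_const_mult sum card_L2_mons_2 card_L2_mons_3)
qed

lemma hilbert_decomp_L2: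
  obtains D where "hilbert_decomp 10 (supported L2_mons :: 'k::field mpoly set) D"
    "\<And>p. p \<in> set D \<Longrightarrow> 6 \<le> card (snd p)"
proof -
  \<comment> \<open>The dimensions depend on the number of variables alone, so {1..k} serves for
    every summand; multiplicities, shifts and sizes below are those of
    \<open>hs_identity\<close>.\<close>
  let ?r = "\<lambda>m s k. replicate m (s, {1..k})"
  define D :: "(nat \<times> nat set) list" where
    "D = ?r 12 2 6 @ ?r 49 4 6 @ ?r 34 5 6 @ ?r 82 6 6 @ ?r 110 7 6 @ ?r 155 8 7 @ ?r 54 9 8
       @ ?r 11 10 9 @ ?r 1 11 10"
  have D: "snd p \<subseteq> {1..10} \<and> 6 \<le> card (snd p)" if "p \<in> set D" for p
    using that unfolding D_def set_append Un_iff set_replicate_conv_if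
    by (elim disjE) (auto split: if_splits)
  then have fin: "finite (snd p)" if "p \<in> set D" for p
    using that finite_subset by blast
  define t where "t d p = (case p of (s, Z) \<Rightarrow> if s \<le> d then card (mons_deg Z (d - s)) else 0)"
    for d and p :: "nat \<times> nat set"
  have coeff: "fps_nth (fps_X ^ s * hs k) d = int (t d (s, {1..k}))" for s d k
    by (simp add: t_def fps_X_power_mult_nth hs_def card_mons_deg)
  have "card (hilbert_basis D d) = card {v \<in> L2_mons. mon_deg v = d}" for d
  proof -
    have "card (hilbert_basis D d) = (\<Sum>p\<leftarrow>D. t d p)"
      unfolding t_def by (rule card_hilbert_basis) (rule fin)
    also have "int \<dots> = int (card {v \<in> L2_mons. mon_deg v = d})"
      unfolding card_L2_mons_deg_hs hs_identity fps_add_nth numeral_fps_const fps_mult_left_const_nth coeff D_def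
      by (simp add: sum_list_replicate)
    finally show ?thesis by simp
  qed
  then have "\<exists>\<phi>. graded_iso (supported L2_mons :: 'k mpoly set) D \<phi>"
    using finite_L2_mons_deg fin by (intro graded_iso_of_card_hilbert_basis) auto
  with D have "hilbert_decomp 10 (supported L2_mons :: 'k mpoly set) D"
    unfolding hilbert_decomp_def by fastforce
  with D that show thesis by blast
qed

theorem mainTheorem9:
  fixes L2 :: "'k::field mpoly set"
  assumes "L2 = Idl\<^bsub>poly_ring 10\<^esub>
                  ({var 1 ^ 2} \<union> {var 1 * var j | j. j \<in> {2..10}} \<union> {var 2 ^ 2, var 2 * var 3})"
  shows "lex_ideal 10 L2 \<and>
         sdepth 10 L2 = 5 \<and> sdepth 10 L2 < hdepth 10 L2 \<and> hdepth 10 L2 = 6"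
proof -
  have L2: "L2 = supported L2_mons"
    unfolding assms by (rule L2_eq)
  obtain D where "stanley_decomp 10 L2 D" "\<And>p. p \<in> set D \<Longrightarrow> 5 \<le> card (snd p)"
    using stanley_decomp_L2 L2 by metis
  then have "sdepth 10 L2 = 5"
    unfolding sdepth_def L2 by (intro Max_decomp_depth_eqI stanley_decomp_L2_small_piece)
  moreover obtain D' where "hilbert_decomp 10 L2 D'" "\<And>p. p \<in> set D' \<Longrightarrow> 6 \<le> card (snd p)"
    using hilbert_decomp_L2 L2 by metis
  then have "hdepth 10 L2 = 6"
    unfolding hdepth_def L2 by (intro Max_decomp_depth_eqI hilbert_decomp_L2_small_piece)
  ultimately show ?thesis
    using lex_ideal_L2 by (simp add: L2)
qed

end
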